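(* Let $K,L\ge 0$ be integers, let $n=K+L+1$, and let $\mu=(K+1,1^L)$. Then the ideal $I_\mu$ of $\mathbb{Q}[x_1,\dots,x_n,y_1,\dots,y_n]$ is generated by the following polynomials: $$h_i(x_1,\dots,x_n)\ (1\le i\le n),\qquad h_i(y_1,\dots,y_n)\ (1\le i\le n),\qquad x_iy_i\ (1\le i\le n),$$ $$\prod_{x\in X}x\ \text{ for all } X\subset\{x_1,\dots,x_n\} \text{ with } |X|=L+1,\qquad \prod_{y\in Y}y\ \text{ for all } Y\subset\{y_1,\dots,y_n\}\text{ with } |Y|=K+1.$$
   Context: Here $\mu=(K+1,1^L)$ is the hook-shaped partition of $n=K+L+1$ with one part $K+1$ and $L$ parts $1$. Its biexponents are the pairs $(0,0),(0,1),\dots,(0,K),(1,0),\dots,(L,0)$, listed in lexicographic order as $(p_1,q_1),\dots,(p_n,q_n)$, and $$\Delta_\mu(x,y)=\det\big(x_i^{p_j}y_i^{q_j}\big)_{i,j=1,\dots,n}.$$ For a polynomial $P$, $P(\partial)$ denotes the differential operator obtained by replacing each $x_i$ by $\partial_{x_i}$ and each $y_i$ by $\partial_{y_i}$. $I_\mu=\{P\in\mathbb{Q}[x_1,\dots,x_n,y_1,\dots,y_n] : P(\partial)\Delta_\mu=0\}$ is the annihilator ideal of $\Delta_\mu$. $h_k$ denotes the $k$-th complete homogeneous symmetric polynomial. *)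

theory Defs
  imports
    "HOL-Library.Poly_Mapping"
    "HOL-Library.Multiset"
    "HOL-Algebra.Ideal"
    "Jordan_Normal_Form.Determinant"
begin

datatype var = X nat | Y nat

text \<open>
  Rational polynomials in the infinitely many variables \<open>X i\<close>, \<open>Y i\<close>, as finitely supported
  coefficient functions on finitely supported exponent vectors. The polynomial ring in
  \<open>x\<^sub>1, \<dots>, x\<^sub>n, y\<^sub>1, \<dots>, y\<^sub>n\<close> is the subring \<open>poly_ring n\<close> below.
\<close>

type_synonym mpol = "(var \<Rightarrow>\<^sub>0 nat) \<Rightarrow>\<^sub>0 rat"

definition Const :: "rat \<Rightarrow> mpol" where
  "Const c = Poly_Mapping.single 0 c"

definition Var :: "var \<Rightarrow> mpol" where
  "Var v = Poly_Mapping.single (Poly_Mapping.single v 1) 1"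

definition vars_upto :: "nat \<Rightarrow> var set" where
  "vars_upto n = X ` {1..n} \<union> Y ` {1..n}"

definition poly_ring :: "nat \<Rightarrow> mpol ring" where
  "poly_ring n =
     \<lparr>carrier = {P. \<forall>m \<in> Poly_Mapping.keys P. Poly_Mapping.keys m \<subseteq> vars_upto n},
      monoid.mult = (*), one = 1, zero = 0, add = (+)\<rparr>"

lemma carrier_poly_ring:
  "P \<in> carrier (poly_ring n) \<longleftrightarrow>
     (\<forall>m \<in> Poly_Mapping.keys P. Poly_Mapping.keys m \<subseteq> vars_upto n)"
  by (simp add: poly_ring_def)

lemma poly_ring_simps [simp]:
  "P \<otimes>\<^bsub>poly_ring n\<^esub> Q = P * Q" "P \<oplus>\<^bsub>poly_ring n\<^esub> Q = P + Q"
  "\<one>\<^bsub>poly_ring n\<^esub> = 1" "\<zero>\<^bsub>poly_ring n\<^esub> = 0"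
  by (simp_all add: poly_ring_def)

lemma poly_ring_cring: "cring (poly_ring n)"
proof (rule cringI)
  show "abelian_group (poly_ring n)"
  proof (rule abelian_groupI)
    fix P Q assume "P \<in> carrier (poly_ring n)" "Q \<in> carrier (poly_ring n)"
    then show "P \<oplus>\<^bsub>poly_ring n\<^esub> Q \<in> carrier (poly_ring n)"
      using keys_add[of P Q] by (auto simp: carrier_poly_ring)
  next
    fix P assume "P \<in> carrier (poly_ring n)"
    then show "\<exists>Q \<in> carrier (poly_ring n). Q \<oplus>\<^bsub>poly_ring n\<^esub> P = \<zero>\<^bsub>poly_ring n\<^esub>"
      by (intro bexI[of _ "- P"]) (auto simp: carrier_poly_ring in_keys_iff)
  qed (auto simp: carrier_poly_ring ac_simps)
next
  show "Group.comm_monoid (poly_ring n)"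
  proof (rule comm_monoidI)
    fix P Q assume P: "P \<in> carrier (poly_ring n)" and Q: "Q \<in> carrier (poly_ring n)"
    show "P \<otimes>\<^bsub>poly_ring n\<^esub> Q \<in> carrier (poly_ring n)"
      unfolding carrier_poly_ring poly_ring_simps
    proof
      fix m assume "m \<in> Poly_Mapping.keys (P * Q)"
      then obtain a b where "m = a + b" "a \<in> Poly_Mapping.keys P" "b \<in> Poly_Mapping.keys Q"
        using keys_mult[of P Q] by auto
      then show "Poly_Mapping.keys m \<subseteq> vars_upto n"
        using P Q keys_add[of a b] unfolding carrier_poly_ring by blast
    qed
  qed (auto simp: carrier_poly_ring ac_simps)
qed (auto simp: algebra_simps)

text \<open>
  The partial derivative with respect to \<open>v\<close>. Where \<open>v\<close> does not occur in \<open>m\<close>, the subtraction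
  of exponents truncates, but then the coefficient vanishes.
\<close>

definition pdiff :: "var \<Rightarrow> mpol \<Rightarrow> mpol" where
  "pdiff v P = (\<Sum>m \<in> Poly_Mapping.keys P.
     Poly_Mapping.single (m - Poly_Mapping.single v 1)
       (of_nat (Poly_Mapping.lookup m v) * Poly_Mapping.lookup P m))"

text \<open>
  The operator \<open>P(\<partial>)\<close> for \<open>P\<close> in \<open>poly_ring n\<close>; variables outside \<open>vars_upto n\<close> are ignored.
  The partial derivatives commute, so the order of composition is immaterial.
\<close>

definition diff_monom :: "nat \<Rightarrow> (var \<Rightarrow>\<^sub>0 nat) \<Rightarrow> mpol \<Rightarrow> mpol" where
  "diff_monom n m =
     foldr (\<lambda>i D. (pdiff (X i) ^^ Poly_Mapping.lookup m (X i)) \<circ> (pdiff (Y i) ^^ Poly_Mapping.lookup m (Y i)) \<circ> D)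
       [1..<n+1] id"

definition diff_op :: "nat \<Rightarrow> mpol \<Rightarrow> mpol \<Rightarrow> mpol" where
  "diff_op n P F = (\<Sum>m \<in> Poly_Mapping.keys P. Const (Poly_Mapping.lookup P m) * diff_monom n m F)"

definition hook_biexponents :: "nat \<Rightarrow> nat \<Rightarrow> (nat \<times> nat) list" where
  "hook_biexponents K L = map (\<lambda>q. (0, q)) [0..<K+1] @ map (\<lambda>p. (p, 0)) [1..<L+1]"

text \<open>Matrix indices start at 0, hence the shift in the variables.\<close>

definition Delta :: "(nat \<times> nat) list \<Rightarrow> mpol" where
  "Delta bs = det (mat (length bs) (length bs)
     (\<lambda>(i, j). Var (X (i + 1)) ^ fst (bs ! j) * Var (Y (i + 1)) ^ snd (bs ! j)))"

definition hook_annihilator :: "nat \<Rightarrow> nat \<Rightarrow> mpol set" where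
  "hook_annihilator K L =
     {P \<in> carrier (poly_ring (K + L + 1)).
        diff_op (K + L + 1) P (Delta (hook_biexponents K L)) = 0}"

text \<open>
  \<open>h\<^sub>k(z\<^sub>1, \<dots>, z\<^sub>n)\<close>; a monomial of degree \<open>k\<close> is given by the multiset of its indices.
\<close>

definition complete_hom :: "nat \<Rightarrow> nat \<Rightarrow> (nat \<Rightarrow> mpol) \<Rightarrow> mpol" where
  "complete_hom k n z = (\<Sum>M \<in> multisets_of_size {1..n} k. \<Prod>i\<in>#M. z i)"

end

theory Submission
  imports Defs
begin

text \<open>
  Two ideas carry the proof.

  The first removes the differential operators. Whether \<open>P(\<partial>)\<close> kills \<open>\<Delta>\<close> depends only on the
  coefficients of \<open>\<Delta>\<close> weighted by factorials of exponents, on which \<open>P\<close> acts by shifting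
  (\<open>contract\<close>). In every monomial of \<open>\<Delta>\<close> each index \<open>i\<close> has \<open>x\<^sub>i\<close>-exponent or \<open>y\<^sub>i\<close>-exponent zero,
  so a monomial is an integer vector \<open>z\<close> (exponent of \<open>x\<^sub>i\<close> minus exponent of \<open>y\<^sub>i\<close>); the monomials of
  \<open>\<Delta>\<close> are the arrangements \<open>z\<close> of \<open>{-K..L}\<close>, the factorials are the same for all of them, and
  the coefficient is up to a common factor the sign of the arrangement (\<open>hook_weight\<close>,
  \<open>Delta_weight\<close>). In this form it is visible that the listed generators kill \<open>\<Delta>\<close>, and that
  shifting by \<open>x\<^sub>n^L\<close> or \<open>y\<^sub>n^K\<close> turns the weight of the hook with arm \<open>K\<close> and leg \<open>L\<close>
  into that of the hook with a shorter leg or arm, in one index less and up to sign.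

  The second is a statement about ideals \<open>I a b\<close> of an arbitrary commutative ring (\<open>a\<close> is the
  leg, \<open>b\<close> the arm): if they are related by these two shifts, contain the expected generators, and
  are right for a single index, then they are generated by them (locale \<open>hook_ideals\<close>, theorem \<open>I_eq_hook_ideal\<close>). Write \<open>J n L K\<close>
  (\<open>hook_ideal\<close>) for the ideal generated by the \<open>h\<^sub>i(x)\<close>, the \<open>h\<^sub>i(y)\<close>, the \<open>x\<^sub>i y\<^sub>i\<close>, the products of \<open>L + 1\<close> of
  the \<open>x\<^sub>i\<close> and of \<open>K + 1\<close> of the \<open>y\<^sub>i\<close>, where now \<open>n\<close>, \<open>L\<close>, \<open>K\<close> are independent. The proof
  is an induction on \<open>n\<close> that eliminates the last pair of variables: modulo \<open>J n L K\<close> an element is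
  \<open>P\<^sub>0 + \<Sum> x\<^sub>n^a P\<^sub>a + \<Sum> y\<^sub>n^b Q\<^sub>b\<close>, and membership in the \<open>I a b\<close> is passed on to the
  coefficients. It does not close within hooks: \<open>P\<^sub>0\<close> lies in the two ideals for shorter leg
  and shorter arm at once, and the two top coefficients are not independent, since
  \<open>y\<^sub>n^c\<close> times a product of \<open>N - c\<close> of the \<open>x\<^sub>i\<close> (with \<open>N = n - 1\<close>) agrees up to sign with a power of
  \<open>x\<^sub>n\<close> times the product of the complementary \<open>y\<^sub>i\<close>. Therefore two claims are proved together:

  \<^item> for \<open>n \<le> L + K + 1\<close>, \<open>J n L K\<close> contains the intersection of the \<open>I a b\<close> with \<open>a \<le> L\<close>, \<open>b \<le> K\<close>,
    \<open>a + b + 1 = n\<close> (\<open>intersection_claim\<close>);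
  \<^item> for \<open>n = L + K + 2\<close>, \<open>J n L K\<close> contains every element that all products of \<open>L + 1\<close> of the \<open>x\<^sub>i\<close>
    multiply into \<open>I (L + 1) K\<close> (\<open>colon_claim\<close>).

  The first governs \<open>P\<^sub>0\<close> and the lower coefficients, the second the two top coefficients of a hook.
\<close>

section \<open>Ideals of a commutative ring and symmetric polynomials\<close>

text \<open>Keeps the index intervals \<open>{1..n}\<close> in one form.\<close>

declare One_nat_def [simp del]

text \<open>An ideal is a submodule of the ring over itself, so the span operator generates ideals.\<close>

global_interpretation ideals: Modules.module "(*) :: 'a::comm_ring_1 \<Rightarrow> 'a \<Rightarrow> 'a"
  defines ideal_span = ideals.span and is_ideal = ideals.subspace
  by unfold_locales (auto simp: algebra_simps)

text \<open>As a rewrite rule it would reassociate products against \<open>mult.assoc\<close>.\<close>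

declare ideals.scale_scale [simp del]

lemmas ideal_mult = ideals.subspace_scale
lemmas ideal_add = ideals.subspace_add
lemmas ideal_diff = ideals.subspace_diff

lemma ideal_mult': "is_ideal S \<Longrightarrow> p \<in> S \<Longrightarrow> p * q \<in> S"
  by (metis ideal_mult mult.commute)

lemma ideal_cong:
  assumes "is_ideal S" "p - q \<in> S"
  shows "p \<in> S \<longleftrightarrow> q \<in> S"
  using assms ideal_add[of S "p - q" q] ideal_diff[of S p "p - q"] by auto

definition hsym :: "nat set \<Rightarrow> nat \<Rightarrow> (nat \<Rightarrow> 'a::comm_ring_1) \<Rightarrow> 'a" where
  "hsym T k z = (\<Sum>M \<in> multisets_of_size T k. \<Prod>i\<in>#M. z i)"

definition esym :: "nat set \<Rightarrow> nat \<Rightarrow> (nat \<Rightarrow> 'a::comm_ring_1) \<Rightarrow> 'a" where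
  "esym T k z = (\<Sum>A | A \<subseteq> T \<and> card A = k. \<Prod>i\<in>A. z i)"

lemma finite_multisets_of_size: "finite T \<Longrightarrow> finite (multisets_of_size T k)"
proof -
  assume "finite T"
  have "multisets_of_size T k \<subseteq> mset ` {xs. set xs \<subseteq> T \<and> length xs = k}"
  proof
    fix M assume M: "M \<in> multisets_of_size T k"
    obtain xs where "M = mset xs" by (metis ex_mset)
    then show "M \<in> mset ` {xs. set xs \<subseteq> T \<and> length xs = k}"
      using M by (auto simp: multisets_of_size_def)
  qed
  then show ?thesis
    using finite_lists_length_eq[OF \<open>finite T\<close>, of k] finite_surj by blast
qed

lemma hsym_0 [simp]: "hsym T 0 z = 1"
  by (simp add: hsym_def)

lemma hsym_empty_Suc [simp]: "hsym {} (Suc k) z = 0"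
  by (simp add: hsym_def)

text \<open>
  A monomial either avoids \<open>s\<close> or has a factor \<open>z s\<close> to split off.
\<close>

lemma hsym_rec:
  assumes "finite T" "s \<in> T"
  shows "hsym T (Suc k) z = hsym (T - {s}) (Suc k) z + z s * hsym T k z"
proof -
  have split: "multisets_of_size T (Suc k) = multisets_of_size (T - {s}) (Suc k) \<union> add_mset s ` multisets_of_size T k"
    (is "?l = ?r")
  proof (rule Set.set_eqI)
    fix M
    show "M \<in> ?l \<longleftrightarrow> M \<in> ?r"
    proof (cases "s \<in># M")
      case True
      then obtain M' where "M = add_mset s M'" by (metis multi_member_split)
      then show ?thesis using assms by (auto simp: multisets_of_size_def image_iff)
    next
      case False
      then show ?thesis by (auto simp: multisets_of_size_def)
    qed
  qed
  have disj: "multisets_of_size (T - {s}) (Suc k) \<inter> add_mset s ` multisets_of_size T k = {}"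
    by (auto simp: multisets_of_size_def)
  have "hsym T (Suc k) z = hsym (T - {s}) (Suc k) z + (\<Sum>M \<in> add_mset s ` multisets_of_size T k. \<Prod>i\<in>#M. z i)"
    unfolding hsym_def split
    by (rule sum.union_disjoint) (use assms disj in \<open>simp_all add: finite_multisets_of_size\<close>)
  also have "(\<Sum>M \<in> add_mset s ` multisets_of_size T k. \<Prod>i\<in>#M. z i) = z s * hsym T k z"
    by (subst sum.reindex) (auto simp: hsym_def sum_distrib_left inj_on_def)
  finally show ?thesis .
qed

lemma hsym_singleton: "hsym {s} k z = z s ^ k"
  by (induction k) (simp_all add: hsym_rec[of "{s}" s])

lemma esym_0 [simp]: "finite T \<Longrightarrow> esym T 0 z = 1"
proof -
  assume "finite T"
  then have "{A. A \<subseteq> T \<and> card A = 0} = {{}}"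
    by (auto simp: card_eq_0_iff dest: finite_subset)
  then show ?thesis by (simp add: esym_def)
qed

lemma esym_eq_0: "finite T \<Longrightarrow> card T < k \<Longrightarrow> esym T k z = 0"
proof -
  assume "finite T" "card T < k"
  then have "{A. A \<subseteq> T \<and> card A = k} = {}"
    by (auto dest: card_mono)
  then show ?thesis by (simp only: esym_def sum.empty)
qed

lemma esym_card: "finite T \<Longrightarrow> esym T (card T) z = prod z T"
proof -
  assume "finite T"
  then have "{A. A \<subseteq> T \<and> card A = card T} = {T}"
    using card_subset_eq by blast
  then show ?thesis by (simp add: esym_def)
qed

lemma esym_insert:
  assumes "finite T" "s \<notin> T"
  shows "esym (insert s T) (Suc k) z = esym T (Suc k) z + z s * esym T k z"
proof -
  have split: "{A. A \<subseteq> insert s T \<and> card A = Suc k} =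
      {A. A \<subseteq> T \<and> card A = Suc k} \<union> insert s ` {A. A \<subseteq> T \<and> card A = k}" (is "?l = ?r")
  proof (rule Set.set_eqI)
    fix A
    show "A \<in> ?l \<longleftrightarrow> A \<in> ?r"
    proof (cases "s \<in> A")
      case True
      then obtain A' where A: "A = insert s A'" "s \<notin> A'" by (metis Set.set_insert)
      show ?thesis
      proof
        assume "A \<in> ?l"
        then have "A' \<subseteq> T"
          using A by auto
        moreover from this have "finite A'"
          using assms finite_subset by blast
        ultimately have "A' \<subseteq> T" "card A' = k"
          using A \<open>A \<in> ?l\<close> by auto
        then show "A \<in> ?r" using A by blast
      next
        assume "A \<in> ?r"
        then obtain A'' where A'': "A = insert s A''" "A'' \<subseteq> T" "card A'' = k"
          using True assms by auto
        then have "finite A''" "s \<notin> A''"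
          using assms finite_subset by blast+
        then show "A \<in> ?l" using A'' by auto
      qed
    next
      case False
      then show ?thesis by auto
    qed
  qed
  have "esym (insert s T) (Suc k) z = esym T (Suc k) z + (\<Sum>A \<in> insert s ` {A. A \<subseteq> T \<and> card A = k}. prod z A)"
    unfolding esym_def split
    by (rule sum.union_disjoint) (use assms in auto)
  also have "(\<Sum>A \<in> insert s ` {A. A \<subseteq> T \<and> card A = k}. prod z A) = z s * esym T k z"
    unfolding esym_def sum_distrib_left
  proof (subst sum.reindex)
    show "inj_on (insert s) {A. A \<subseteq> T \<and> card A = k}"
      using assms by (intro inj_onI) (auto simp: insert_ident subset_iff)
    have "prod z (insert s A) = z s * prod z A" if "A \<subseteq> T" for A
      using that assms finite_subset[of A T] by (intro prod.insert) auto
    then show "sum (prod z \<circ> insert s) {A. A \<subseteq> T \<and> card A = k} = (\<Sum>A | A \<subseteq> T \<and> card A = k. z s * prod z A)"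
      by (intro sum.cong) auto
  qed
  finally show ?thesis .
qed

lemma hsym_interval_Suc:
  "1 \<le> i \<Longrightarrow> hsym {1..N} i z = hsym {1..Suc N} i z - z (Suc N) * hsym {1..Suc N} (i - 1) z"
proof -
  assume "1 \<le> i"
  then obtain k where i: "i = Suc k" by (cases i) auto
  have "{1..Suc N} - {Suc N} = {1..N}" by auto
  then show ?thesis using hsym_rec[of "{1..Suc N}" "Suc N" k z] by (simp add: i)
qed

section \<open>The hook ideal and its relations\<close>

text \<open>
  Unlike in the theorem, \<open>n\<close>, \<open>L\<close> and \<open>K\<close> are independent, and all variables with index outside
  \<open>{1..n}\<close> are generators. Thus the ideals for different \<open>n\<close> live in the same ring, and
  passing from \<open>Suc N\<close> to \<open>N\<close> kills the last pair of variables.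
\<close>

inductive_set hook_gens :: "(nat \<Rightarrow> 'a::comm_ring_1) \<Rightarrow> (nat \<Rightarrow> 'a) \<Rightarrow> nat \<Rightarrow> nat \<Rightarrow> nat \<Rightarrow> 'a set"
  for x y :: "nat \<Rightarrow> 'a" and n L K :: nat where
  hsym_x: "1 \<le> i \<Longrightarrow> i \<le> n \<Longrightarrow> hsym {1..n} i x \<in> hook_gens x y n L K"
| hsym_y: "1 \<le> i \<Longrightarrow> i \<le> n \<Longrightarrow> hsym {1..n} i y \<in> hook_gens x y n L K"
| xy: "1 \<le> i \<Longrightarrow> i \<le> n \<Longrightarrow> x i * y i \<in> hook_gens x y n L K"
| prod_x: "A \<subseteq> {1..n} \<Longrightarrow> card A = Suc L \<Longrightarrow> prod x A \<in> hook_gens x y n L K"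
| prod_y: "B \<subseteq> {1..n} \<Longrightarrow> card B = Suc K \<Longrightarrow> prod y B \<in> hook_gens x y n L K"
| outside_x: "i \<notin> {1..n} \<Longrightarrow> x i \<in> hook_gens x y n L K"
| outside_y: "i \<notin> {1..n} \<Longrightarrow> y i \<in> hook_gens x y n L K"

definition hook_ideal :: "(nat \<Rightarrow> 'a::comm_ring_1) \<Rightarrow> (nat \<Rightarrow> 'a) \<Rightarrow> nat \<Rightarrow> nat \<Rightarrow> nat \<Rightarrow> 'a set" where
  "hook_ideal x y n L K = ideal_span (hook_gens x y n L K)"

lemma is_ideal_hook_ideal [simp]: "is_ideal (hook_ideal x y n L K)"
  by (simp add: hook_ideal_def)

lemma hook_ideal_swap: "hook_ideal x y n L K = hook_ideal y x n K L"
proof -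
  have "hook_gens x y n L K \<subseteq> hook_gens y x n K L" for x y :: "nat \<Rightarrow> 'a" and L K
  proof
    fix p assume "p \<in> hook_gens x y n L K"
    then show "p \<in> hook_gens y x n K L"
    proof cases
      case (xy i)
      then show ?thesis using hook_gens.xy[of i n y x K L] by (simp add: mult.commute)
    qed (simp_all add: hook_gens.intros)
  qed
  then have "hook_gens x y n L K = hook_gens y x n K L" by (intro equalityI)
  then show ?thesis by (simp add: hook_ideal_def)
qed

lemma hook_ideal_leI:
  assumes "is_ideal S"
    and "\<And>i. 1 \<le> i \<Longrightarrow> i \<le> n \<Longrightarrow> hsym {1..n} i x \<in> S"
    and "\<And>i. 1 \<le> i \<Longrightarrow> i \<le> n \<Longrightarrow> hsym {1..n} i y \<in> S"
    and "\<And>i. 1 \<le> i \<Longrightarrow> i \<le> n \<Longrightarrow> x i * y i \<in> S"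
    and "\<And>A. A \<subseteq> {1..n} \<Longrightarrow> card A = Suc L \<Longrightarrow> (\<Prod>i\<in>A. x i) \<in> S"
    and "\<And>B. B \<subseteq> {1..n} \<Longrightarrow> card B = Suc K \<Longrightarrow> (\<Prod>i\<in>B. y i) \<in> S"
    and "\<And>i. i \<notin> {1..n} \<Longrightarrow> x i \<in> S" "\<And>i. i \<notin> {1..n} \<Longrightarrow> y i \<in> S"
  shows "hook_ideal x y n L K \<subseteq> S"
  unfolding hook_ideal_def
proof (rule ideals.span_minimal)
  show "hook_gens x y n L K \<subseteq> S"
  proof
    fix p assume "p \<in> hook_gens x y n L K"
    then show "p \<in> S" by cases (simp_all add: assms)
  qed
qed fact

context
  fixes x y :: "nat \<Rightarrow> 'a::comm_ring_1"
begin

lemma hook_gens_subset: "hook_gens x y n L K \<subseteq> hook_ideal x y n L K"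
  unfolding hook_ideal_def by (rule ideals.span_superset)

lemma hsym_in_hook_ideal:
  "1 \<le> i \<Longrightarrow> i \<le> n \<Longrightarrow> hsym {1..n} i x \<in> hook_ideal x y n L K"
  "1 \<le> i \<Longrightarrow> i \<le> n \<Longrightarrow> hsym {1..n} i y \<in> hook_ideal x y n L K"
  by (simp_all add: subsetD[OF hook_gens_subset] hook_gens.intros)

lemma outside_in_hook_ideal:
  "i \<notin> {1..n} \<Longrightarrow> x i \<in> hook_ideal x y n L K"
  "i \<notin> {1..n} \<Longrightarrow> y i \<in> hook_ideal x y n L K"
  by (simp_all add: subsetD[OF hook_gens_subset] hook_gens.intros)

lemma xy_in_hook_ideal: "x i * y i \<in> hook_ideal x y n L K"
proof (cases "i \<in> {1..n}")
  case True
  then show ?thesis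
    by (simp add: subsetD[OF hook_gens_subset] hook_gens.intros)
next
  case False
  then show ?thesis
    by (intro ideal_mult'[OF is_ideal_hook_ideal] outside_in_hook_ideal)
qed

lemma prod_x_in_hook_ideal:
  assumes "A \<subseteq> {1..n}" "L < card A"
  shows "prod x A \<in> hook_ideal x y n L K"
proof -
  obtain A' where A': "A' \<subseteq> A" "card A' = Suc L" "finite A'"
    using obtain_subset_with_card_n[of "Suc L" A] assms by (metis Suc_leI)
  have "prod x A' \<in> hook_ideal x y n L K"
    using subset_trans[OF A'(1) assms(1)] A'(2)
    by (simp add: subsetD[OF hook_gens_subset] hook_gens.intros)
  moreover have "prod x A = prod x (A - A') * prod x A'"
    using A' assms finite_subset[of A "{1..n}"] by (simp add: prod.subset_diff)
  ultimately show ?thesis by (simp add: ideal_mult)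
qed

text \<open>
  In the quotient, \<open>\<Prod> (1 - x\<^sub>i t) = 1\<close> over all indices, so the generating function of the
  \<open>h\<^sub>k\<close> of some variables is \<open>\<Prod> (1 - x\<^sub>i t)\<close> over the others, that is, \<open>h\<^sub>k\<close> is \<open>(-1)^k e\<^sub>k\<close> of the
  complement. After multiplication by the \<open>y\<^sub>i\<close> with \<open>i \<in> B\<close>, the \<open>x\<^sub>i\<close> with \<open>i \<in> B\<close> vanish
  and drop out of \<open>e\<^sub>k\<close>. The induction moves one index at a time from the
  \<open>h\<close>-side to the \<open>e\<close>-side.
\<close>

lemma hsym_complement:
  assumes "U \<subseteq> {1..n}" "k \<le> n" "B \<subseteq> {1..n}"
  shows "prod y B * (hsym ({1..n} - U) k x - (-1) ^ k * esym (U - B) k x) \<in> hook_ideal x y n L K"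
    (is "?f U k \<in> ?J")
proof -
  have "finite U" using assms finite_subset by blast
  then show ?thesis using assms(1,2)
  proof (induction U arbitrary: k rule: finite_induct)
    case empty
    show ?case
    proof (cases k)
      case 0
      then show ?thesis by (simp add: ideals.subspace_0)
    next
      case (Suc j)
      then show ?thesis using empty
        by (auto simp: esym_eq_0 intro!: ideal_mult hsym_in_hook_ideal)
    qed
  next
    case (insert s U)
    show ?case
    proof (cases k)
      case 0
      then show ?thesis using insert by (simp add: ideals.subspace_0)
    next
      case (Suc j)
      have s: "s \<in> {1..n} - U" using insert by auto
      have eq: "{1..n} - U - {s} = {1..n} - insert s U" by auto
      have h: "hsym ({1..n} - insert s U) k x = hsym ({1..n} - U) k x - x s * hsym ({1..n} - U) j x"
        using hsym_rec[OF _ s, of j x] by (simp add: Suc eq)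
      have IH: "?f U k \<in> ?J" "?f U j \<in> ?J"
        using insert.IH[of k] insert.IH[of j] insert.prems Suc by auto
      show ?thesis
      proof (cases "s \<in> B")
        case True
        have eB: "insert s U - B = U - B" using True by auto
        have "finite B" using assms(3) finite_subset by blast
        then have "prod y B * x s = prod y (B - {s}) * (x s * y s)"
          unfolding prod.remove[OF \<open>finite B\<close> True] by (simp only: mult_ac)
        then have "prod y B * x s \<in> ?J"
          by (simp only: ideal_mult xy_in_hook_ideal is_ideal_hook_ideal)
        then have *: "(prod y B * x s) * hsym ({1..n} - U) j x \<in> ?J"
          by (rule ideal_mult'[OF is_ideal_hook_ideal])
        have "?f (insert s U) k = ?f U k - (prod y B * x s) * hsym ({1..n} - U) j x"
          unfolding h eB by (simp add: algebra_simps)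
        then show ?thesis using IH * by (simp add: ideal_diff)
      next
        case False
        have "insert s U - B = insert s (U - B)" using False by auto
        then have "esym (insert s U - B) k x = esym (U - B) k x + x s * esym (U - B) j x"
          using esym_insert[of "U - B" s j x] insert.hyps by (simp add: Suc)
        then have "?f (insert s U) k = ?f U k - x s * ?f U j"
          unfolding h by (simp add: Suc algebra_simps)
        then show ?thesis using IH by (simp add: ideal_diff ideal_mult)
      qed
    qed
  qed
qed

text \<open>
  The case of a single variable on the \<open>h\<close>-side: powers of the last variable are elementary
  symmetric in the others. All relations for powers of \<open>x\<^sub>n\<close> and \<open>y\<^sub>n\<close> come from here.
\<close>

lemma x_power_times_y_prod:
  assumes "B \<subseteq> {1..N}" "k \<le> Suc N"
  shows "x (Suc N) ^ k * prod y B - (-1) ^ k * esym ({1..N} - B) k x * prod y B \<in> hook_ideal x y (Suc N) L K"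
proof -
  have "{1..Suc N} - {1..N} = {Suc N}" "B \<subseteq> {1..Suc N}" using assms by auto
  then show ?thesis
    using hsym_complement[of "{1..N}" "Suc N" k B L K] assms
    by (auto simp: hsym_singleton right_diff_distrib mult_ac)
qed

lemma esym_in_hook_ideal: "T \<subseteq> {1..n} \<Longrightarrow> L < k \<Longrightarrow> esym T k x \<in> hook_ideal x y n L K"
  unfolding esym_def by (rule ideals.subspace_sum[OF is_ideal_hook_ideal]) (auto intro: prod_x_in_hook_ideal)

text \<open>
  Here \<open>e\<^sub>a\<close> has fewer than \<open>a\<close> variables left.
\<close>

lemma x_power_times_y_prod_in:
  assumes "B \<subseteq> {1..N}" "a \<le> Suc N" "N < a + card B"
  shows "x (Suc N) ^ a * prod y B \<in> hook_ideal x y (Suc N) L K"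
proof -
  have "card ({1..N} - B) < a"
    using assms finite_subset[OF assms(1)] card_mono[OF _ assms(1)] by (simp add: card_Diff_subset)
  then have "esym ({1..N} - B) a x = 0"
    by (intro esym_eq_0) auto
  then show ?thesis
    using x_power_times_y_prod[OF assms(1,2), of L K] by simp
qed

lemma x_power_in_hook_ideal: "L < a \<Longrightarrow> x (Suc N) ^ a \<in> hook_ideal x y (Suc N) L K"
proof (induction a rule: less_induct)
  case (less a)
  show ?case
  proof (cases "a \<le> Suc N")
    case True
    have "esym {1..N} a x \<in> hook_ideal x y (Suc N) L K"
      by (rule esym_in_hook_ideal) (use less in auto)
    then show ?thesis
      using x_power_times_y_prod[of "{}" N a L K] True
      by (simp add: ideal_cong[OF is_ideal_hook_ideal] ideal_mult)
  next
    case False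
    have "x (Suc N) ^ Suc N \<in> hook_ideal x y (Suc N) L K"
      using x_power_times_y_prod_in[of "{}" N "Suc N"] by simp
    moreover have "x (Suc N) ^ a = x (Suc N) ^ (a - Suc N) * x (Suc N) ^ Suc N"
      using False by (simp flip: power_add del: power_Suc)
    ultimately show ?thesis by (simp only: ideal_mult[OF is_ideal_hook_ideal])
  qed
qed

lemma x_power_in_esym:
  assumes "k \<le> Suc N"
  shows "x (Suc N) ^ k - (-1) ^ k * esym {1..N} k x \<in> hook_ideal x y (Suc N) L K"
  using x_power_times_y_prod[of "{}" N k L K] assms by simp

text \<open>
  Here \<open>e\<^sub>a\<close> has exactly \<open>a\<close> variables left, so only their product remains.
\<close>

lemma x_power_split:
  assumes "A \<subseteq> {1..N}"
  shows "x (Suc N) ^ card A * prod y ({1..N} - A) - (-1) ^ card A * prod x A * prod y ({1..N} - A)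
           \<in> hook_ideal x y (Suc N) L K"
proof -
  have "{1..N} - ({1..N} - A) = A" using assms by auto
  moreover have "card A \<le> Suc N" using card_mono[OF _ assms] by simp
  moreover have "finite A" using assms finite_subset by blast
  ultimately show ?thesis
    using x_power_times_y_prod[of "{1..N} - A" N "card A" L K] by (simp add: esym_card)
qed

text \<open>
  The product of all variables is \<open>e\<^sub>n\<close>. Hence \<open>L\<close> and \<open>K\<close> matter only up to \<open>n - 1\<close>
  (\<open>hook_ideal_min\<close>).
\<close>

lemma prod_x_full_in_hook_ideal:
  assumes "A \<subseteq> {1..Suc N}" "card A = Suc N"
  shows "prod x A \<in> hook_ideal x y (Suc N) L K"
proof -
  have A: "A = {1..Suc N}"
    using card_subset_eq[of "{1..Suc N}" A] assms by simp
  have "(-1) ^ Suc N * prod x A \<in> hook_ideal x y (Suc N) L K"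
    using hsym_complement[of "{1..Suc N}" "Suc N" "Suc N" "{}" L K] esym_card[of "{1..Suc N}" x]
      ideals.subspace_neg[OF is_ideal_hook_ideal, of "- ((-1) ^ Suc N * prod x A)"]
    by (auto simp: A)
  from ideal_mult[OF is_ideal_hook_ideal this, of "(-1) ^ Suc N"] show ?thesis
    by (simp flip: mult.assoc power_mult_distrib del: power_Suc)
qed

end

lemma prod_y_in_hook_ideal:
  assumes "B \<subseteq> {1..n}" "K < card B"
  shows "prod y B \<in> hook_ideal x y n L K"
  unfolding hook_ideal_swap[of x y n L K] by (rule prod_x_in_hook_ideal[OF assms])

lemma prod_y_full_in_hook_ideal:
  assumes "B \<subseteq> {1..Suc N}" "card B = Suc N"
  shows "prod y B \<in> hook_ideal x y (Suc N) L K"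
  unfolding hook_ideal_swap[of x y "Suc N" L K] by (rule prod_x_full_in_hook_ideal[OF assms])

context
  fixes x y :: "nat \<Rightarrow> 'a::comm_ring_1"
begin

lemma hook_ideal_mono:
  assumes "L \<le> L'" "K \<le> K'"
  shows "hook_ideal x y n L' K' \<subseteq> hook_ideal x y n L K"
proof (rule hook_ideal_leI)
  fix B assume B: "B \<subseteq> {1..n}" "card B = Suc K'"
  show "prod y B \<in> hook_ideal x y n L K"
    by (rule prod_y_in_hook_ideal) (use B assms in auto)
next
  fix A assume A: "A \<subseteq> {1..n}" "card A = Suc L'"
  show "prod x A \<in> hook_ideal x y n L K"
    by (rule prod_x_in_hook_ideal) (use A assms in auto)
qed (simp_all add: hsym_in_hook_ideal outside_in_hook_ideal xy_in_hook_ideal)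

lemma hook_ideal_min:
  "hook_ideal x y (Suc N) (min L N) (min K N) \<subseteq> hook_ideal x y (Suc N) L K"
proof (rule hook_ideal_leI)
  fix A assume A: "A \<subseteq> {1..Suc N}" "card A = Suc (min L N)"
  show "prod x A \<in> hook_ideal x y (Suc N) L K"
  proof (cases "L \<le> N")
    case True
    show ?thesis by (rule prod_x_in_hook_ideal) (use A True in auto)
  next
    case False
    show ?thesis by (rule prod_x_full_in_hook_ideal) (use A False in auto)
  qed
next
  fix A assume A: "A \<subseteq> {1..Suc N}" "card A = Suc (min K N)"
  show "prod y A \<in> hook_ideal x y (Suc N) L K"
  proof (cases "K \<le> N")
    case True
    show ?thesis by (rule prod_y_in_hook_ideal) (use A True in auto)
  next
    case False
    show ?thesis by (rule prod_y_full_in_hook_ideal) (use A False in auto)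
  qed
qed (simp_all add: hsym_in_hook_ideal outside_in_hook_ideal xy_in_hook_ideal)

text \<open>
  Modulo the last pair of variables the generators in \<open>Suc N\<close> and in \<open>N\<close> indices coincide.
\<close>

lemma hook_ideal_Suc_le:
  assumes "is_ideal S" "hook_ideal x y (Suc N) L K \<subseteq> S" "x (Suc N) \<in> S" "y (Suc N) \<in> S"
  shows "hook_ideal x y N L K \<subseteq> S"
proof (rule hook_ideal_leI)
  have J: "p \<in> S" if "p \<in> hook_ideal x y (Suc N) L K" for p
    using that assms by blast
  show "is_ideal S" by fact
  show "hsym {1..N} i x \<in> S" if "1 \<le> i" "i \<le> N" for i
    using that ideal_diff[OF assms(1) J[OF hsym_in_hook_ideal(1)[of i "Suc N"]]
        ideal_mult'[OF assms(1) assms(3)]]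
    by (simp only: hsym_interval_Suc[OF that(1), of N] le_SucI)
  show "hsym {1..N} i y \<in> S" if "1 \<le> i" "i \<le> N" for i
    using that ideal_diff[OF assms(1) J[OF hsym_in_hook_ideal(2)[of i "Suc N"]]
        ideal_mult'[OF assms(1) assms(4)]]
    by (simp only: hsym_interval_Suc[OF that(1), of N] le_SucI)
  show "x i * y i \<in> S" for i
    by (rule J) (rule xy_in_hook_ideal)
  show "prod x A \<in> S" if "A \<subseteq> {1..N}" "card A = Suc L" for A
    by (rule J, rule prod_x_in_hook_ideal) (use that in force)+
  show "prod y A \<in> S" if "A \<subseteq> {1..N}" "card A = Suc K" for A
    by (rule J, rule prod_y_in_hook_ideal) (use that in force)+
  show "x i \<in> S" if "i \<notin> {1..N}" for i
    using that assms J[OF outside_in_hook_ideal(1), of i] by (cases "i = Suc N") auto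
  show "y i \<in> S" if "i \<notin> {1..N}" for i
    using that assms J[OF outside_in_hook_ideal(2), of i] by (cases "i = Suc N") auto
qed

text \<open>
  The elimination step: a coefficient of \<open>x\<^sub>n^a\<close> that lies in a hook ideal of the first \<open>N\<close>
  indices can be traded for higher powers of \<open>x\<^sub>n\<close>. Since \<open>x\<^sub>n\<close> times \<open>h\<^sub>i\<close> of \<open>N\<close> variables is \<open>- x\<^sub>n\<^sup>2 h\<^bsub>i-1\<^esub>\<close>
  of all of them up to generators, \<open>x\<^sub>n y\<^sub>n\<close> is a generator, and \<open>x\<^sub>n\<close> lengthens a product of \<open>x\<^sub>i\<close> by one, only
  the products of \<open>y\<^sub>i\<close> need a separate hypothesis. The target \<open>S\<close> is left open because
  some of these products are exchanged for powers of the other variable.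
\<close>

lemma x_power_times_hook_ideal:
  assumes S: "is_ideal S" "hook_ideal x y (Suc N) L K \<subseteq> S"
    and a: "1 \<le> a" "x (Suc N) ^ Suc a \<in> S" and l: "L \<le> Suc l"
    and B: "\<And>B. B \<subseteq> {1..N} \<Longrightarrow> card B = Suc k \<Longrightarrow> x (Suc N) ^ a * prod y B \<in> S"
    and U: "U \<in> hook_ideal x y N l k"
  shows "x (Suc N) ^ a * U \<in> S"
proof -
  let ?v = "x (Suc N)"
  have J: "p \<in> S" if "p \<in> hook_ideal x y (Suc N) L K" for p
    using that S by blast
  have v: "?v ^ a * p \<in> S" if "?v * p \<in> S" for p
  proof -
    have "?v ^ a * p = ?v ^ (a - 1) * (?v * p)"
      using a by (cases a) (auto simp: mult_ac)
    then show ?thesis using that S by (simp add: ideal_mult)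
  qed
  have "hook_ideal x y N l k \<subseteq> {U. ?v ^ a * U \<in> S}"
  proof (rule hook_ideal_leI)
    show "is_ideal {U. ?v ^ a * U \<in> S}"
    proof (rule ideals.subspaceI)
      show "c * p \<in> {U. ?v ^ a * U \<in> S}" if "p \<in> {U. ?v ^ a * U \<in> S}" for c p
        using that ideal_mult[OF S(1), of "?v ^ a * p" c] by (simp add: mult_ac)
    qed (use S in \<open>auto simp: algebra_simps ideal_add ideals.subspace_0\<close>)
    show "hsym {1..N} i x \<in> {U. ?v ^ a * U \<in> S}" if "1 \<le> i" "i \<le> N" for i
    proof -
      have "?v ^ a * hsym {1..N} i x = ?v ^ a * hsym {1..Suc N} i x - hsym {1..Suc N} (i - 1) x * ?v ^ Suc a"
        unfolding hsym_interval_Suc[OF that(1), of N] by (simp add: algebra_simps)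
      moreover have "?v ^ a * hsym {1..Suc N} i x \<in> S"
        by (rule ideal_mult[OF S(1) J[OF hsym_in_hook_ideal(1)]]) (use that in auto)
      ultimately show ?thesis using S a by (simp only: ideal_diff ideal_mult mem_Collect_eq)
    qed
    show "hsym {1..N} i y \<in> {U. ?v ^ a * U \<in> S}" if "1 \<le> i" "i \<le> N" for i
    proof -
      have "?v * hsym {1..N} i y = ?v * hsym {1..Suc N} i y - hsym {1..Suc N} (i - 1) y * (?v * y (Suc N))"
        unfolding hsym_interval_Suc[OF that(1), of N] by (simp add: algebra_simps)
      moreover have "?v * hsym {1..Suc N} i y \<in> S"
        by (rule ideal_mult[OF S(1) J[OF hsym_in_hook_ideal(2)]]) (use that in auto)
      moreover have "?v * y (Suc N) \<in> S"
        by (rule J) (rule xy_in_hook_ideal)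
      ultimately have "?v * hsym {1..N} i y \<in> S" using S by (simp only: ideal_diff ideal_mult)
      then show ?thesis using v by blast
    qed
    show "x i * y i \<in> {U. ?v ^ a * U \<in> S}" for i
      using ideal_mult[OF S(1) J[OF xy_in_hook_ideal]] by simp
    show "prod x A \<in> {U. ?v ^ a * U \<in> S}" if A: "A \<subseteq> {1..N}" "card A = Suc l" for A
    proof -
      have fin: "finite A" "Suc N \<notin> A" using A finite_subset by auto
      then have "?v * prod x A = prod x (insert (Suc N) A)" by simp
      also have "\<dots> \<in> S"
        by (rule J, rule prod_x_in_hook_ideal) (use A l fin in auto)
      finally show ?thesis using v by blast
    qed
    show "prod y A \<in> {U. ?v ^ a * U \<in> S}" if "A \<subseteq> {1..N}" "card A = Suc k" for A
      using B that by blast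
    have "?v ^ a * x (Suc N) \<in> S" using a by (simp add: mult.commute)
    moreover have "?v ^ a * y (Suc N) \<in> S"
      by (rule v, rule J) (rule xy_in_hook_ideal)
    ultimately show "x i \<in> {U. ?v ^ a * U \<in> S}" "y i \<in> {U. ?v ^ a * U \<in> S}" if "i \<notin> {1..N}" for i
      using that ideal_mult[OF S(1) J[OF outside_in_hook_ideal(1)], of i "?v ^ a"]
        ideal_mult[OF S(1) J[OF outside_in_hook_ideal(2)], of i "?v ^ a"]
      by (cases "i = Suc N"; auto)+
  qed
  then show ?thesis using U by blast
qed

end

lemma y_power_in_hook_ideal: "K < a \<Longrightarrow> y (Suc N) ^ a \<in> hook_ideal x y (Suc N) L K"
  using x_power_in_hook_ideal by (subst hook_ideal_swap)

lemma y_power_times_x_prod_in: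
  assumes "A \<subseteq> {1..N}" "a \<le> Suc N" "N < a + card A"
  shows "y (Suc N) ^ a * prod x A \<in> hook_ideal x y (Suc N) L K"
  using x_power_times_y_prod_in[OF assms] by (subst hook_ideal_swap)

lemma y_power_times_hook_ideal:
  assumes S: "is_ideal S" "hook_ideal x y (Suc N) L K \<subseteq> S"
    and a: "1 \<le> a" "y (Suc N) ^ Suc a \<in> S" and l: "K \<le> Suc k"
    and B: "\<And>A. A \<subseteq> {1..N} \<Longrightarrow> card A = Suc l \<Longrightarrow> y (Suc N) ^ a * prod x A \<in> S"
    and U: "U \<in> hook_ideal x y N l k"
  shows "y (Suc N) ^ a * U \<in> S"
proof (rule x_power_times_hook_ideal[of S y x N K L a k l])
  show "hook_ideal y x (Suc N) K L \<subseteq> S"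
    using S(2) by (subst hook_ideal_swap)
  show "U \<in> hook_ideal y x N k l"
    using U by (subst hook_ideal_swap)
qed (use assms in blast)+

text \<open>
  Both \<open>y\<^sub>n^c\<close> times the \<open>x\<^sub>i\<close> with \<open>i \<in> A\<close> and \<open>x\<^sub>n^a\<close> (\<open>a = card A\<close>) times the \<open>y\<^sub>i\<close> of the complement agree
  up to sign with the product of these \<open>x\<^sub>i\<close> and \<open>y\<^sub>i\<close>. This relation couples the powers of the two last
  variables.
\<close>

lemma y_power_times_x_prod_exchange:
  assumes A: "A \<subseteq> {1..N}" and c: "c + card A = N" and S: "is_ideal S" "hook_ideal x y (Suc N) L K \<subseteq> S"
    and x: "x (Suc N) ^ card A \<in> S"
  shows "y (Suc N) ^ c * prod x A \<in> S"
proof -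
  have fin: "finite A" using A finite_subset by blast
  define B where "B = {1..N} - A"
  have AB: "B \<subseteq> {1..N}" "{1..N} - B = A" "card B = c"
    using A c fin by (auto simp: B_def card_Diff_subset)
  have J: "p \<in> S" if "p \<in> hook_ideal x y (Suc N) L K" for p
    using that S by blast
  have "x (Suc N) ^ card A * prod y B - (-1) ^ card A * prod x A * prod y B \<in> S"
    using J[OF x_power_split[OF A]] by (simp add: B_def)
  then have "(-1) ^ card A * prod x A * prod y B \<in> S"
    using ideal_cong[OF S(1)] ideal_mult'[OF S(1) x] by blast
  from ideal_mult[OF S(1) this, of "(-1) ^ card A"] have xy: "prod x A * prod y B \<in> S"
    by (simp flip: mult.assoc power_mult_distrib)
  have "y (Suc N) ^ c * prod x A - (-1) ^ c * (prod x A * prod y B) \<in> S"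
    using J[OF x_power_split[of B N y x K L, OF AB(1), unfolded hook_ideal_swap[of y x _ K L]]] AB
    by (simp add: mult_ac)
  then show ?thesis
    using ideal_cong[OF S(1)] ideal_mult[OF S(1) xy] by blast
qed

section \<open>Eliminating the last pair of variables\<close>

text \<open>
  What is left after the coefficients of lower powers of \<open>x\<^sub>n\<close> and \<open>y\<^sub>n\<close> have been eliminated. The
  proof raises \<open>a\<close> and \<open>c\<close> until both powers lie in the hook ideal.
\<close>

definition pair_ideal :: "(nat \<Rightarrow> 'a::comm_ring_1) \<Rightarrow> (nat \<Rightarrow> 'a) \<Rightarrow> nat \<Rightarrow> nat \<Rightarrow> nat \<Rightarrow> nat \<Rightarrow> nat \<Rightarrow> 'a set" where
  "pair_ideal x y n L K a c = ideal_span (insert (x n ^ a) (insert (y n ^ c) (hook_ideal x y n L K)))"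

lemma is_ideal_pair_ideal [simp]: "is_ideal (pair_ideal x y n L K a c)"
  by (simp add: pair_ideal_def)

lemma pair_ideal_swap: "pair_ideal x y n L K a c = pair_ideal y x n K L c a"
  unfolding pair_ideal_def by (simp add: hook_ideal_swap[of x y n L K] insert_commute)

lemma in_pair_ideal:
  "P \<in> pair_ideal x y n L K a c \<longleftrightarrow> (\<exists>U V. P - U * x n ^ a - V * y n ^ c \<in> hook_ideal x y n L K)"
  unfolding pair_ideal_def ideals.span_breakdown_eq ideals.span_eq_iff[THEN iffD2, OF is_ideal_hook_ideal] by simp

lemma hook_ideal_le_pair_ideal: "hook_ideal x y n L K \<subseteq> pair_ideal x y n L K a c"
  unfolding pair_ideal_def by (meson ideals.span_superset order_trans subset_insertI)

lemma powers_in_pair_ideal: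
  "a \<le> a' \<Longrightarrow> x n ^ a' \<in> pair_ideal x y n L K a c"
  "c \<le> c' \<Longrightarrow> y n ^ c' \<in> pair_ideal x y n L K a c"
proof -
  have *: "x n ^ a \<in> pair_ideal x y n L K a c" "y n ^ c \<in> pair_ideal x y n L K a c"
    unfolding pair_ideal_def by (rule ideals.span_base; simp)+
  show "x n ^ a' \<in> pair_ideal x y n L K a c" if "a \<le> a'"
    using ideal_mult[OF is_ideal_pair_ideal *(1), of "x n ^ (a' - a)"] that
    by (simp flip: power_add)
  show "y n ^ c' \<in> pair_ideal x y n L K a c" if "c \<le> c'"
    using ideal_mult[OF is_ideal_pair_ideal *(2), of "y n ^ (c' - c)"] that
    by (simp flip: power_add)
qed

lemma pair_ideal_eq_hook_ideal:
  assumes "x n ^ a \<in> hook_ideal x y n L K" "y n ^ c \<in> hook_ideal x y n L K"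
  shows "pair_ideal x y n L K a c = hook_ideal x y n L K"
  using assms by (simp add: pair_ideal_def insert_absorb ideals.span_eq_iff[THEN iffD2, OF is_ideal_hook_ideal])

lemma ideal_remainder:
  assumes S: "is_ideal S" and "P - U - V \<in> S" "P \<in> S" "U \<in> S"
  shows "V \<in> S"
proof -
  have "V = P - U - (P - U - V)" by simp
  then show ?thesis using assms by (metis ideal_diff)
qed

lemma ideal_recombine:
  assumes S: "is_ideal S" and "P - U - V \<in> S" "U \<in> S" "V \<in> S"
  shows "P \<in> S"
proof -
  have "P = (P - U - V) + (U + V)" by simp
  then show ?thesis using assms by (metis ideal_add)
qed

lemma esym_full_in_hook_ideal:
  assumes "1 \<le> k" "k \<le> n"
  shows "esym {1..n} k x \<in> hook_ideal x y n L K"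
proof -
  obtain j where "k = Suc j" using assms by (cases k) auto
  then have "- ((-1) ^ k * esym {1..n} k x) \<in> hook_ideal x y n L K"
    using hsym_complement[of "{1..n}" n k "{}" y x L K] assms by simp
  from ideal_mult[OF is_ideal_hook_ideal this, of "- ((-1) ^ k)"] show ?thesis
    by (simp flip: mult.assoc power_mult_distrib)
qed

text \<open>
  With \<open>L\<close> the size of \<open>A\<close>, multiply \<open>e\<^sub>L\<close> of all variables, which is in the ideal, by the product over
  \<open>A\<close>: every term but the square contains \<open>L + 1\<close> different variables.
\<close>

lemma prod_x_square_in_hook_ideal:
  assumes A: "A \<subseteq> {1..n}" "card A = L" "1 \<le> L"
  shows "prod x A * prod x A \<in> hook_ideal x y n L K" (is "_ \<in> ?J")
proof -
  have fin: "finite A" using A finite_subset by blast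
  have L: "L \<le> n" using card_mono[OF _ A(1)] A(2) by simp
  define F where "F = {A'. A' \<subseteq> {1..n} \<and> card A' = L}"
  have F: "finite F" "A \<in> F" using A by (auto simp: F_def)
  have "prod x A * esym {1..n} L x \<in> ?J"
    using A L by (intro ideal_mult[OF is_ideal_hook_ideal] esym_full_in_hook_ideal)
  also have "prod x A * esym {1..n} L x = prod x A * prod x A + prod x A * (\<Sum>A'\<in>F - {A}. prod x A')"
    using F by (simp add: esym_def F_def[symmetric] sum.remove[of F A] distrib_left)
  finally have *: "prod x A * prod x A + prod x A * (\<Sum>A'\<in>F - {A}. prod x A') \<in> ?J" .
  have "prod x A * (\<Sum>A'\<in>F - {A}. prod x A') \<in> ?J"
    unfolding sum_distrib_left
  proof (rule ideals.subspace_sum[OF is_ideal_hook_ideal])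
    fix A' assume A': "A' \<in> F - {A}"
    then have fin': "finite A'" and "A' \<subseteq> {1..n}" "card A' = L" "A' \<noteq> A"
      by (auto simp: F_def intro: finite_subset)
    then have "\<not> A' \<subseteq> A" using A fin card_subset_eq by metis
    then have "A \<subset> A \<union> A'" by blast
    then have "L < card (A \<union> A')"
      using psubset_card_mono[of "A \<union> A'" A] fin fin' A by simp
    then have "prod x (A \<union> A') \<in> ?J"
      using A \<open>A' \<subseteq> {1..n}\<close> by (intro prod_x_in_hook_ideal) auto
    then show "prod x A * prod x A' \<in> ?J"
      using prod.union_inter[OF fin fin', of x] ideal_mult'[OF is_ideal_hook_ideal] by metis
  qed
  from ideal_diff[OF is_ideal_hook_ideal * this] show ?thesis by simp
qed

text \<open>
  For \<open>n = L + K + 1\<close> the intersection consists of the single ideal \<open>I L K\<close>, and the claim is the theorem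
  for a hook. Larger \<open>L\<close> and \<open>K\<close> arise from the constant terms.
\<close>

definition intersection_claim :: "(nat \<Rightarrow> 'a::comm_ring_1) \<Rightarrow> (nat \<Rightarrow> 'a) \<Rightarrow> (nat \<Rightarrow> nat \<Rightarrow> 'a set) \<Rightarrow> nat \<Rightarrow> bool" where
  "intersection_claim x y I n \<longleftrightarrow>
     (\<forall>L K P. n \<le> Suc (L + K) \<longrightarrow> (\<forall>a b. a \<le> L \<longrightarrow> b \<le> K \<longrightarrow> Suc (a + b) = n \<longrightarrow> P \<in> I a b)
        \<longrightarrow> P \<in> hook_ideal x y n L K)"

text \<open>
  For \<open>\<Delta>\<close>, the product of the \<open>x\<^sub>i\<close> with \<open>i \<in> A\<close> sends the determinant of the hook with leg \<open>L + 1\<close> and arm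
  \<open>K\<close>, up to a constant, to the product of the Vandermonde determinants in the \<open>x\<^sub>i\<close> with \<open>i \<in> A\<close> and in
  the \<open>y\<^sub>i\<close> with \<open>i \<notin> A\<close>; the
  claim describes the polynomials that kill all these products.
\<close>

definition colon_claim :: "(nat \<Rightarrow> 'a::comm_ring_1) \<Rightarrow> (nat \<Rightarrow> 'a) \<Rightarrow> (nat \<Rightarrow> nat \<Rightarrow> 'a set) \<Rightarrow> nat \<Rightarrow> bool" where
  "colon_claim x y I n \<longleftrightarrow>
     (\<forall>L K P. n = Suc (Suc (L + K)) \<longrightarrow>
        (\<forall>A. A \<subseteq> {1..n} \<longrightarrow> card A = Suc L \<longrightarrow> prod x A * P \<in> I (Suc L) K)
        \<longrightarrow> P \<in> hook_ideal x y n L K)"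

lemma intersection_claimD:
  assumes "intersection_claim x y I n" "n \<le> Suc (L + K)"
    and "\<And>a b. a \<le> L \<Longrightarrow> b \<le> K \<Longrightarrow> Suc (a + b) = n \<Longrightarrow> P \<in> I a b"
  shows "P \<in> hook_ideal x y n L K"
  using assms unfolding intersection_claim_def by blast

lemma colon_claimD:
  assumes "colon_claim x y I n" "n = Suc (Suc (L + K))"
    and "\<And>A. A \<subseteq> {1..n} \<Longrightarrow> card A = Suc L \<Longrightarrow> prod x A * P \<in> I (Suc L) K"
  shows "P \<in> hook_ideal x y n L K"
  using assms unfolding colon_claim_def by blast

lemma intersection_claim_swap:
  assumes "intersection_claim x y I n"
  shows "intersection_claim y x (\<lambda>a b. I b a) n"
  unfolding intersection_claim_def
proof (intro allI impI)
  fix L K P assume *: "n \<le> Suc (L + K)" "\<forall>a b. a \<le> L \<longrightarrow> b \<le> K \<longrightarrow> Suc (a + b) = n \<longrightarrow> P \<in> I b a"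
  show "P \<in> hook_ideal y x n L K"
    unfolding hook_ideal_swap[of y x n L K]
    by (rule intersection_claimD[OF assms]) (use * in \<open>auto simp: add.commute\<close>)
qed

text \<open>
  The abstract form of the annihilators of the \<open>\<Delta>\<close> of all hooks: \<open>I a b\<close> belongs to the hook with leg \<open>a\<close>
  and arm \<open>b\<close>, in \<open>a + b + 1\<close> indices.
\<close>

locale hook_ideals =
  fixes x y :: "nat \<Rightarrow> 'a::comm_ring_1" and I :: "nat \<Rightarrow> nat \<Rightarrow> 'a set"
  assumes is_ideal_I [simp]: "is_ideal (I a b)"
    and x_top: "x (Suc (Suc (a + b))) ^ Suc a * P \<in> I (Suc a) b \<longleftrightarrow> P \<in> I a b"
    and y_top: "y (Suc (Suc (a + b))) ^ Suc b * P \<in> I a (Suc b) \<longleftrightarrow> P \<in> I a b"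
    and hook_ideal_le: "hook_ideal x y (Suc (a + b)) a b \<subseteq> I a b"
    and I_0_0: "I 0 0 \<subseteq> hook_ideal x y 1 0 0"
begin

lemma swapped: "hook_ideals y x (\<lambda>a b. I b a)"
proof
  fix a b P
  show "y (Suc (Suc (a + b))) ^ Suc a * P \<in> I b (Suc a) \<longleftrightarrow> P \<in> I b a"
    using y_top[of b a P] by (simp only: add.commute)
  show "x (Suc (Suc (a + b))) ^ Suc b * P \<in> I (Suc b) a \<longleftrightarrow> P \<in> I b a"
    using x_top[of b a P] by (simp only: add.commute)
  show "hook_ideal y x (Suc (a + b)) a b \<subseteq> I b a"
    using hook_ideal_le[of b a] by (simp add: hook_ideal_swap[of y x _ a b] add.commute)
  show "I 0 0 \<subseteq> hook_ideal y x 1 0 0"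
    using I_0_0 by (simp add: hook_ideal_swap[of y x 1 0 0])
qed simp

lemma hook_ideal_subset_I:
  assumes "a \<le> L" "b \<le> K" "n = Suc (a + b)"
  shows "hook_ideal x y n L K \<subseteq> I a b"
  using hook_ideal_mono[OF assms(1,2), of x y n] hook_ideal_le[of a b] assms(3) by blast

text \<open>
  One elimination step for \<open>y\<^sub>n\<close>. Multiplying by \<open>y\<^sub>n\<close> until the power is the top one of a hook
  \<open>(a', b' + 1)\<close> with \<open>b' \<ge> c\<close> kills the \<open>x\<^sub>n\<close>-part and shows that the coefficient \<open>V\<close> lies in \<open>I a' b'\<close>.
  Hooks with \<open>b' < c\<close> are missing, which restricts the leg to \<open>N - 1 - c\<close>: the price is products of
  \<open>N - c\<close> of the \<open>x\<^sub>i\<close>, and these are exchanged for \<open>x\<^sub>n^(N - c)\<close>. The hypothesis \<open>a + c \<le> N\<close> ensures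
  that this power is already allowed.
\<close>

lemma y_step:
  assumes claim: "intersection_claim x y I N" and LK: "N \<le> L + K"
    and kills: "\<And>a b. a \<le> L \<Longrightarrow> b \<le> K \<Longrightarrow> a + b = N \<Longrightarrow> P \<in> I a b"
    and ac: "1 \<le> a" "1 \<le> c" "c < K" "a + c \<le> N"
    and P: "P \<in> pair_ideal x y (Suc N) L K a c"
  shows "P \<in> pair_ideal x y (Suc N) L K a (Suc c)" (is "P \<in> ?S")
proof -
  let ?J = "hook_ideal x y (Suc N) L K" and ?x = "x (Suc N)" and ?y = "y (Suc N)"
  obtain U V where UV: "P - U * ?x ^ a - V * ?y ^ c \<in> ?J"
    using P unfolding in_pair_ideal by blast
  define l where "l = min L (N - 1 - c)"
  have V: "V \<in> hook_ideal x y N l (K - 1)"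
  proof (rule intersection_claimD[OF claim])
    show "N \<le> Suc (l + (K - 1))" using LK ac unfolding l_def by linarith
    fix a' b' assume ab: "a' \<le> l" "b' \<le> K - 1" "Suc (a' + b') = N"
    then have b: "c \<le> b'" "a' \<le> L" "Suc b' \<le> K" using ac unfolding l_def by linarith+
    have sub: "?J \<subseteq> I a' (Suc b')"
      by (rule hook_ideal_subset_I) (use b ab in auto)
    define d where "d = b' - c"
    have d: "Suc b' = Suc d + c" using b by (simp add: d_def)
    have "?y ^ Suc d * (P - U * ?x ^ a - V * ?y ^ c) \<in> I a' (Suc b')"
      using sub UV by (intro ideal_mult[OF is_ideal_I]) blast
    then have *: "?y ^ Suc d * P - ?y ^ Suc d * (U * ?x ^ a) - ?y ^ Suc b' * V \<in> I a' (Suc b')"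
      by (simp add: d algebra_simps power_add)
    obtain a0 where a0: "a = Suc a0" using ac by (cases a) auto
    have "?y ^ Suc d * (U * ?x ^ a) = (?y ^ d * U * ?x ^ a0) * (?x * ?y)"
      by (simp add: a0 mult_ac)
    then have "?y ^ Suc d * (U * ?x ^ a) \<in> I a' (Suc b')"
      using sub xy_in_hook_ideal[of x "Suc N" y "Suc N" L K] by (metis ideal_mult is_ideal_I subsetD)
    moreover have "?y ^ Suc d * P \<in> I a' (Suc b')"
      by (intro ideal_mult[OF is_ideal_I] kills) (use b ab in auto)
    ultimately have "?y ^ Suc b' * V \<in> I a' (Suc b')"
      using ideal_remainder[OF is_ideal_I *] by blast
    then show "V \<in> I a' b'" using y_top[of a' b' V] ab(3) by simp
  qed
  have "?y ^ c * V \<in> ?S"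
  proof (rule y_power_times_hook_ideal[OF is_ideal_pair_ideal hook_ideal_le_pair_ideal _ _ _ _ V])
    show "?y ^ Suc c \<in> ?S" by (rule powers_in_pair_ideal) simp
    show "K \<le> Suc (K - 1)" by simp
    fix A assume A: "A \<subseteq> {1..N}" "card A = Suc l"
    show "?y ^ c * prod x A \<in> ?S"
    proof (cases "L \<le> N - 1 - c")
      case True
      have "prod x A \<in> ?J"
        by (rule prod_x_in_hook_ideal) (use A True in \<open>auto simp: l_def\<close>)
      then show ?thesis
        using hook_ideal_le_pair_ideal by (intro ideal_mult[OF is_ideal_pair_ideal]) blast
    next
      case False
      then have "c + card A = N" using A ac by (simp add: l_def)
      then show ?thesis
        using A ac by (intro y_power_times_x_prod_exchange[OF _ _ is_ideal_pair_ideal hook_ideal_le_pair_ideal]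
            powers_in_pair_ideal) auto
    qed
  qed (use ac in simp)
  then have "V * ?y ^ c \<in> ?S" by (simp add: mult.commute)
  moreover have "U * ?x ^ a \<in> ?S"
    by (intro ideal_mult[OF is_ideal_pair_ideal] powers_in_pair_ideal) simp
  ultimately show ?thesis
    using ideal_recombine[OF is_ideal_pair_ideal] UV hook_ideal_le_pair_ideal by blast
qed

lemma x_step:
  assumes claim: "intersection_claim x y I N" and LK: "N \<le> L + K"
    and kills: "\<And>a b. a \<le> L \<Longrightarrow> b \<le> K \<Longrightarrow> a + b = N \<Longrightarrow> P \<in> I a b"
    and ac: "1 \<le> a" "1 \<le> c" "a < L" "a + c \<le> N"
    and P: "P \<in> pair_ideal x y (Suc N) L K a c"
  shows "P \<in> pair_ideal x y (Suc N) L K (Suc a) c"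
proof -
  have "P \<in> pair_ideal y x (Suc N) K L c (Suc a)"
  proof (rule hook_ideals.y_step[OF swapped intersection_claim_swap[OF claim]])
    show "P \<in> I b' a'" if "a' \<le> K" "b' \<le> L" "a' + b' = N" for a' b'
      by (rule kills) (use that in auto)
    show "P \<in> pair_ideal y x (Suc N) K L c a"
      using P by (simp only: pair_ideal_swap[of x y])
  qed (use LK ac in auto)
  then show ?thesis by (simp only: pair_ideal_swap[of x y])
qed

text \<open>
  On the hook with arm \<open>K\<close> (hence leg \<open>N - K\<close>) the power \<open>x\<^sub>n^(N - K + 1)\<close> vanishes, so the top coefficient of
  \<open>y\<^sub>n\<close> can be read off alone.
\<close>

lemma clear_y_by_intersection:
  assumes claim: "intersection_claim x y I N" and K: "1 \<le> K" "K \<le> N" and LK: "N \<le> L + K"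
    and kills: "\<And>a b. a \<le> L \<Longrightarrow> b \<le> K \<Longrightarrow> a + b = N \<Longrightarrow> P \<in> I a b"
    and P: "P \<in> pair_ideal x y (Suc N) L K (Suc (N - K)) K"
  shows "P \<in> pair_ideal x y (Suc N) L K 1 (Suc K)" (is "P \<in> ?S")
proof -
  let ?J = "hook_ideal x y (Suc N) L K" and ?x = "x (Suc N)" and ?y = "y (Suc N)"
  obtain U V where UV: "P - U * ?x ^ Suc (N - K) - V * ?y ^ K \<in> ?J"
    using P unfolding in_pair_ideal by blast
  have V: "V \<in> hook_ideal x y N (N - K) (K - 1)"
  proof (rule intersection_claimD[OF claim])
    show "N \<le> Suc (N - K + (K - 1))" using K by simp
    fix a b assume ab: "a \<le> N - K" "b \<le> K - 1" "Suc (a + b) = N"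
    then have a: "a = N - K" "Suc b = K" using K by auto
    have sub: "?J \<subseteq> I a (Suc b)"
      by (rule hook_ideal_subset_I) (use a ab LK in auto)
    have *: "P - U * ?x ^ Suc (N - K) - V * ?y ^ K \<in> I a (Suc b)"
      using sub UV by blast
    have "?x ^ Suc (N - K) \<in> hook_ideal x y (Suc N) a (Suc b)"
      by (rule x_power_in_hook_ideal) (simp add: a)
    then have "U * ?x ^ Suc (N - K) \<in> I a (Suc b)"
      using hook_ideal_le[of a "Suc b"] ab by (intro ideal_mult[OF is_ideal_I]) auto
    moreover have "P \<in> I a (Suc b)"
      by (rule kills) (use a LK K in auto)
    ultimately have "V * ?y ^ K \<in> I a (Suc b)"
      using ideal_remainder[OF is_ideal_I *] by blast
    moreover have "Suc (Suc (a + b)) = Suc N" using ab(3) by simp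
    ultimately show "V \<in> I a b" using y_top[of a b V] a(2) by (metis mult.commute)
  qed
  have "?y ^ K * V \<in> ?S"
  proof (rule y_power_times_hook_ideal[OF is_ideal_pair_ideal hook_ideal_le_pair_ideal K(1) _ _ _ V])
    show "?y ^ Suc K \<in> ?S" by (rule powers_in_pair_ideal) simp
    show "K \<le> Suc (K - 1)" by simp
    fix A assume A: "A \<subseteq> {1..N}" "card A = Suc (N - K)"
    have "?y ^ K * prod x A \<in> ?J"
      by (rule y_power_times_x_prod_in) (use A K in auto)
    then show "?y ^ K * prod x A \<in> ?S" using hook_ideal_le_pair_ideal by blast
  qed
  then have "V * ?y ^ K \<in> ?S" by (simp add: mult.commute)
  moreover have "U * ?x ^ Suc (N - K) \<in> ?S"
    by (intro ideal_mult[OF is_ideal_pair_ideal] powers_in_pair_ideal) simp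
  ultimately show ?thesis
    using ideal_recombine[OF is_ideal_pair_ideal] UV hook_ideal_le_pair_ideal by blast
qed

text \<open>
  The case of a single hook, where both top powers \<open>x\<^sub>n^L\<close> and \<open>y\<^sub>n^K\<close> survive together. A product of \<open>L\<close>
  other \<open>x\<^sub>i\<close> kills \<open>x\<^sub>n^L\<close>, so all such products carry the coefficient \<open>V\<close> of \<open>y\<^sub>n^K\<close> into
  the ideal of the smaller hook; this is what the colon claim is made for. The products of \<open>L\<close> of the
  \<open>x\<^sub>i\<close> that it leaves in \<open>V\<close> are exchanged for \<open>x\<^sub>n^L\<close>.
\<close>

lemma clear_y_by_colon:
  assumes claim: "colon_claim x y I N" and LK: "1 \<le> L" "1 \<le> K" "N = L + K"
    and kill: "P \<in> I L K"
    and P: "P \<in> pair_ideal x y (Suc N) L K L K"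
  shows "P \<in> pair_ideal x y (Suc N) L K 1 (Suc K)" (is "P \<in> ?S")
proof -
  let ?J = "hook_ideal x y (Suc N) L K" and ?x = "x (Suc N)" and ?y = "y (Suc N)"
  obtain U V where UV: "P - U * ?x ^ L - V * ?y ^ K \<in> ?J"
    using P unfolding in_pair_ideal by blast
  have sub: "?J \<subseteq> I L K" by (rule hook_ideal_subset_I) (use LK in auto)
  obtain l k where lk: "L = Suc l" "K = Suc k" using LK by (metis Suc_le_D One_nat_def)
  have V: "V \<in> hook_ideal x y N l k"
  proof (rule colon_claimD[OF claim])
    show "N = Suc (Suc (l + k))" using LK lk by simp
    fix A assume A: "A \<subseteq> {1..N}" "card A = Suc l"
    then have fin: "finite A" "Suc N \<notin> A" using finite_subset by auto
    have "prod x A * (P - U * ?x ^ L - V * ?y ^ K) \<in> I L K"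
      using sub UV by (intro ideal_mult[OF is_ideal_I]) blast
    then have *: "prod x A * P - prod x A * (U * ?x ^ L) - prod x A * V * ?y ^ K \<in> I L K"
      by (simp add: algebra_simps)
    have "prod x (insert (Suc N) A) \<in> ?J"
      by (rule prod_x_in_hook_ideal) (use A fin lk in auto)
    then have "(U * ?x ^ l) * prod x (insert (Suc N) A) \<in> I L K"
      using sub by (intro ideal_mult[OF is_ideal_I]) blast
    then have "prod x A * (U * ?x ^ L) \<in> I L K"
      using fin by (simp add: lk mult_ac)
    moreover have "prod x A * P \<in> I L K" by (intro ideal_mult[OF is_ideal_I] kill)
    ultimately have "prod x A * V * ?y ^ K \<in> I L K"
      using ideal_remainder[OF is_ideal_I *] by blast
    then show "prod x A * V \<in> I (Suc l) k"
      using y_top[of "Suc l" k "prod x A * V"] LK lk by (simp add: mult.commute)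
  qed
  have "?y ^ K * V \<in> ?S"
  proof (rule y_power_times_hook_ideal[OF is_ideal_pair_ideal hook_ideal_le_pair_ideal LK(2) _ _ _ V])
    show "?y ^ Suc K \<in> ?S" by (rule powers_in_pair_ideal) simp
    show "K \<le> Suc k" by (simp add: lk)
    fix A assume A: "A \<subseteq> {1..N}" "card A = Suc l"
    then show "?y ^ K * prod x A \<in> ?S"
      using LK lk by (intro y_power_times_x_prod_exchange[OF _ _ is_ideal_pair_ideal hook_ideal_le_pair_ideal]
            powers_in_pair_ideal) auto
  qed
  then have "V * ?y ^ K \<in> ?S" by (simp add: mult.commute)
  moreover have "U * ?x ^ L \<in> ?S"
    by (intro ideal_mult[OF is_ideal_pair_ideal] powers_in_pair_ideal LK)
  ultimately show ?thesis
    using ideal_recombine[OF is_ideal_pair_ideal] UV hook_ideal_le_pair_ideal by blast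
qed

text \<open>
  Without a \<open>y\<^sub>n\<close>-part there is no interference, so the elimination of \<open>x\<^sub>n\<close> runs through to
  \<open>x\<^sub>n^(L + 1)\<close>, and the leftover products of \<open>N - a + 1\<close> of the \<open>y\<^sub>i\<close> are killed by \<open>x\<^sub>n^a\<close>.
\<close>

lemma x_step_alone:
  assumes claim: "intersection_claim x y I N" and LK: "N \<le> L + K" "L \<le> N"
    and kills: "\<And>a b. a \<le> L \<Longrightarrow> b \<le> K \<Longrightarrow> a + b = N \<Longrightarrow> P \<in> I a b"
    and a: "1 \<le> a" "a \<le> L"
    and P: "P \<in> pair_ideal x y (Suc N) L K a (Suc K)"
  shows "P \<in> pair_ideal x y (Suc N) L K (Suc a) (Suc K)" (is "P \<in> ?S")
proof -
  let ?J = "hook_ideal x y (Suc N) L K" and ?x = "x (Suc N)" and ?y = "y (Suc N)"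
  obtain U V where "P - U * ?x ^ a - V * ?y ^ Suc K \<in> ?J"
    using P unfolding in_pair_ideal by blast
  then have UV: "P - V * ?y ^ Suc K - U * ?x ^ a \<in> ?J"
    by (simp only: diff_diff_eq add.commute)
  define k where "k = min K (N - a)"
  have U: "U \<in> hook_ideal x y N (L - 1) k"
  proof (rule intersection_claimD[OF claim])
    show "N \<le> Suc (L - 1 + k)" using LK a unfolding k_def by linarith
    fix a' b' assume ab: "a' \<le> L - 1" "b' \<le> k" "Suc (a' + b') = N"
    then have b: "a \<le> Suc a'" "Suc a' \<le> L" "b' \<le> K" using a LK unfolding k_def by linarith+
    have sub: "?J \<subseteq> I (Suc a') b'"
      by (rule hook_ideal_subset_I) (use b ab in auto)
    define d where "d = Suc a' - a"
    have d: "Suc a' = d + a" using b by (simp add: d_def)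
    have "?x ^ d * (P - V * ?y ^ Suc K - U * ?x ^ a) \<in> I (Suc a') b'"
      using sub UV by (intro ideal_mult[OF is_ideal_I]) blast
    then have *: "?x ^ d * P - (?x ^ d * V) * ?y ^ Suc K - ?x ^ Suc a' * U \<in> I (Suc a') b'"
      unfolding d power_add by (simp add: algebra_simps)
    have "?y ^ Suc K \<in> ?J" by (rule y_power_in_hook_ideal) simp
    then have "(?x ^ d * V) * ?y ^ Suc K \<in> I (Suc a') b'"
      using sub by (intro ideal_mult[OF is_ideal_I]) blast
    moreover have "?x ^ d * P \<in> I (Suc a') b'"
      by (intro ideal_mult[OF is_ideal_I] kills) (use b ab in auto)
    ultimately have "?x ^ Suc a' * U \<in> I (Suc a') b'"
      using ideal_remainder[OF is_ideal_I *] by blast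
    then show "U \<in> I a' b'" using x_top[of a' b' U] ab(3) by simp
  qed
  have "?x ^ a * U \<in> ?S"
  proof (rule x_power_times_hook_ideal[OF is_ideal_pair_ideal hook_ideal_le_pair_ideal a(1) _ _ _ U])
    show "?x ^ Suc a \<in> ?S" by (rule powers_in_pair_ideal) simp
    show "L \<le> Suc (L - 1)" by simp
    fix B assume B: "B \<subseteq> {1..N}" "card B = Suc k"
    have "?x ^ a * prod y B \<in> ?J"
    proof (cases "K \<le> N - a")
      case True
      show ?thesis
        by (intro ideal_mult[OF is_ideal_hook_ideal] prod_y_in_hook_ideal)
           (use B True in \<open>auto simp: k_def\<close>)
    next
      case False
      show ?thesis
        by (rule x_power_times_y_prod_in) (use B False a LK in \<open>auto simp: k_def\<close>)
    qed
    then show "?x ^ a * prod y B \<in> ?S" using hook_ideal_le_pair_ideal by blast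
  qed
  then have "U * ?x ^ a \<in> ?S" by (simp add: mult.commute)
  moreover have "V * ?y ^ Suc K \<in> ?S"
    by (intro ideal_mult[OF is_ideal_pair_ideal] powers_in_pair_ideal) simp
  ultimately show ?thesis
    using ideal_recombine[OF is_ideal_pair_ideal] UV hook_ideal_le_pair_ideal by blast
qed

text \<open>
  The order of elimination: lower powers of \<open>y\<^sub>n\<close>, then lower powers of \<open>x\<^sub>n\<close> as far as the exchange
  relation permits, then the top power of \<open>y\<^sub>n\<close>, then the rest of \<open>x\<^sub>n\<close>.
\<close>

lemma intersection_claim_Suc_bounded:
  assumes claim: "intersection_claim x y I N" "colon_claim x y I N"
    and LK: "N \<le> L + K" "L \<le> N" "K \<le> N" "1 \<le> N"
    and kills: "\<And>a b. a \<le> L \<Longrightarrow> b \<le> K \<Longrightarrow> a + b = N \<Longrightarrow> P \<in> I a b"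
  shows "P \<in> hook_ideal x y (Suc N) L K"
proof -
  let ?J = "hook_ideal x y (Suc N) L K" and ?x = "x (Suc N)" and ?y = "y (Suc N)"
  let ?G = "pair_ideal x y (Suc N) L K"
  have "P \<in> hook_ideal x y N L K"
  proof (rule intersection_claimD[OF claim(1)])
    show "N \<le> Suc (L + K)" using LK by simp
    fix a b assume ab: "a \<le> L" "b \<le> K" "Suc (a + b) = N"
    show "P \<in> I a b"
    proof (cases "Suc a \<le> L")
      case True
      then have "P \<in> I (Suc a) b" using ab by (intro kills) auto
      then show ?thesis using x_top[of a b P] by (metis ideal_mult is_ideal_I)
    next
      case False
      then have "P \<in> I a (Suc b)" using ab LK by (intro kills) auto
      then show ?thesis using y_top[of a b P] by (metis ideal_mult is_ideal_I)
    qed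
  qed
  moreover have "hook_ideal x y N L K \<subseteq> ?G 1 1"
    by (rule hook_ideal_Suc_le[OF is_ideal_pair_ideal hook_ideal_le_pair_ideal])
       (use powers_in_pair_ideal(1)[of 1 1] powers_in_pair_ideal(2)[of 1 1] in auto)
  ultimately have start: "P \<in> ?G 1 1" by blast
  have clear: "P \<in> ?G 1 (Suc K)"
  proof (cases "K = 0")
    case True
    then show ?thesis using start by (simp add: One_nat_def)
  next
    case False
    have y_steps: "P \<in> ?G 1 c" if "1 \<le> c" "c \<le> K" for c
      using that
    proof (induction c rule: dec_induct)
      case base
      show ?case by (rule start)
    next
      case (step c)
      show ?case
        by (rule y_step[OF claim(1) LK(1) kills]) (use step LK in auto)
    qed
    have x_steps: "P \<in> ?G a K" if "1 \<le> a" "a \<le> L" "a \<le> Suc (N - K)" for a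
      using that
    proof (induction a rule: dec_induct)
      case base
      show ?case using y_steps[of K] False by simp
    next
      case (step a)
      show ?case
        by (rule x_step[OF claim(1) LK(1) kills]) (use step LK False in auto)
    qed
    consider "Suc (N - K) \<le> L" | "L = 0" | "1 \<le> L" "L = N - K"
      using LK by linarith
    then show ?thesis
    proof cases
      case 1
      then have "P \<in> ?G (Suc (N - K)) K" by (intro x_steps) auto
      then show ?thesis
        using False LK by (intro clear_y_by_intersection[OF claim(1) _ _ _ kills]) auto
    next
      case 2
      then have "N - K = 0" using LK by simp
      then have "P \<in> ?G (Suc (N - K)) K" using y_steps[of K] False by (simp add: One_nat_def)
      then show ?thesis
        using False LK by (intro clear_y_by_intersection[OF claim(1) _ _ _ kills]) auto
    next
      case 3
      then have "P \<in> ?G L K" by (intro x_steps) auto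
      then show ?thesis
        using 3 False LK by (intro clear_y_by_colon[OF claim(2) _ _ _ kills]) auto
    qed
  qed
  have "P \<in> ?G a (Suc K)" if "1 \<le> a" "a \<le> Suc L" for a
    using that
  proof (induction a rule: dec_induct)
    case base
    show ?case by (rule clear)
  next
    case (step a)
    show ?case
      by (rule x_step_alone[OF claim(1) LK(1,2) kills]) (use step in auto)
  qed
  from this[of "Suc L"] have "P \<in> ?G (Suc L) (Suc K)" by simp
  moreover have "?x ^ Suc L \<in> ?J" "?y ^ Suc K \<in> ?J"
    by (rule x_power_in_hook_ideal y_power_in_hook_ideal, simp)+
  ultimately show ?thesis
    using pair_ideal_eq_hook_ideal by blast
qed

lemma intersection_claim_Suc:
  assumes claim: "intersection_claim x y I N" "colon_claim x y I N" and N: "1 \<le> N"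
  shows "intersection_claim x y I (Suc N)"
  unfolding intersection_claim_def
proof (intro allI impI)
  fix L K P
  assume n: "Suc N \<le> Suc (L + K)" and *: "\<forall>a b. a \<le> L \<longrightarrow> b \<le> K \<longrightarrow> Suc (a + b) = Suc N \<longrightarrow> P \<in> I a b"
  have "P \<in> hook_ideal x y (Suc N) (min L N) (min K N)"
    by (rule intersection_claim_Suc_bounded[OF claim]) (use n * N in auto)
  then show "P \<in> hook_ideal x y (Suc N) L K"
    using hook_ideal_min by blast
qed

text \<open>
  The converse inclusion to the colon claim. Two products of \<open>L + 1\<close> of the \<open>x\<^sub>i\<close> multiply into the hook ideal
  with leg \<open>L + 1\<close>, since they involve more than \<open>L + 1\<close> indices or form a square.
\<close>

lemma prod_x_hook_ideal_subset_I:
  assumes j: "j \<in> hook_ideal x y (Suc (Suc (L + K))) L K"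
    and A: "A \<subseteq> {1..Suc (Suc (L + K))}" "card A = Suc L"
  shows "prod x A * j \<in> I (Suc L) K"
proof -
  let ?n = "Suc (Suc (L + K))"
  let ?J = "hook_ideal x y ?n (Suc L) K"
  have "hook_ideal x y ?n L K \<subseteq> {j. prod x A * j \<in> ?J}"
  proof (rule hook_ideal_leI)
    show "is_ideal {j. prod x A * j \<in> ?J}"
    proof (rule ideals.subspaceI)
      show "c * p \<in> {j. prod x A * j \<in> ?J}" if "p \<in> {j. prod x A * j \<in> ?J}" for c p
        using that ideal_mult[OF is_ideal_hook_ideal, of "prod x A * p" x y ?n "Suc L" K c] by (simp add: mult_ac)
    qed (auto simp: distrib_left ideal_add ideals.subspace_0)
    fix A' assume A': "A' \<subseteq> {1..?n}" "card A' = Suc L"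
    show "prod x A' \<in> {j. prod x A * j \<in> ?J}"
    proof (cases "A' = A")
      case True
      then show ?thesis using prod_x_square_in_hook_ideal[OF A, of x y K] by simp
    next
      case False
      have fin: "finite A" "finite A'" using A A' finite_subset by auto
      then have "\<not> A' \<subseteq> A" using A A' False card_subset_eq by metis
      then have "A \<subset> A \<union> A'" by blast
      then have "Suc L < card (A \<union> A')"
        using psubset_card_mono[of "A \<union> A'" A] fin A by simp
      then have "prod x (A \<union> A') \<in> ?J"
        using A A' by (intro prod_x_in_hook_ideal) auto
      then show ?thesis
        using prod.union_inter[OF fin, of x] ideal_mult'[OF is_ideal_hook_ideal] by (metis mem_Collect_eq)
    qed
  qed (simp_all add: ideal_mult hsym_in_hook_ideal xy_in_hook_ideal outside_in_hook_ideal prod_y_in_hook_ideal)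
  then show ?thesis using j hook_ideal_le[of "Suc L" K] by auto
qed

text \<open>
  The constant term is covered by the intersection claim because \<open>x\<^sub>n^(L + 1)\<close> is up to sign \<open>e\<^bsub>L+1\<^esub>\<close> of the other
  variables, a sum of the products in the hypothesis. For the coefficients, products with and without the
  last index see \<open>x\<^sub>n\<close> and \<open>y\<^sub>n\<close> separately, so the two eliminations do not interfere.
\<close>

lemma colon_claim_Suc:
  assumes claim: "intersection_claim x y I N" "colon_claim x y I N"
  shows "colon_claim x y I (Suc N)"
  unfolding colon_claim_def
proof (intro allI impI)
  fix L K P
  assume n: "Suc N = Suc (Suc (L + K))"
    and *: "\<forall>A. A \<subseteq> {1..Suc N} \<longrightarrow> card A = Suc L \<longrightarrow> prod x A * P \<in> I (Suc L) K"
  let ?J = "hook_ideal x y (Suc N) L K" and ?x = "x (Suc N)" and ?y = "y (Suc N)"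
  let ?G = "pair_ideal x y (Suc N) L K"
  have kills: "prod x A * P \<in> I (Suc L) K" if "A \<subseteq> {1..Suc N}" "card A = Suc L" for A
    using * that by blast
  have JI: "prod x A * j \<in> I (Suc L) K" if "j \<in> ?J" "A \<subseteq> {1..Suc N}" "card A = Suc L" for A j
    using prod_x_hook_ideal_subset_I[of j L K A] that n by simp
  have sub: "hook_ideal x y (Suc N) (Suc L) K \<subseteq> I (Suc L) K"
    using hook_ideal_le[of "Suc L" K] n by simp
  have "P \<in> hook_ideal x y N L K"
  proof (rule intersection_claimD[OF claim(1)])
    fix a b assume ab: "a \<le> L" "b \<le> K" "Suc (a + b) = N"
    then have eq: "a = L" "b = K" using n by auto
    have "(?x ^ Suc L - (-1) ^ Suc L * esym {1..N} (Suc L) x) * P \<in> I (Suc L) K"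
      using x_power_in_esym[of "Suc L" N x y "Suc L" K] n sub
      by (intro ideal_mult'[OF is_ideal_I]) auto
    moreover have "esym {1..N} (Suc L) x * P \<in> I (Suc L) K"
      unfolding esym_def sum_distrib_right
      by (rule ideals.subspace_sum[OF is_ideal_I], rule kills) auto
    then have "(-1) ^ Suc L * (esym {1..N} (Suc L) x * P) \<in> I (Suc L) K"
      by (rule ideal_mult[OF is_ideal_I])
    ultimately have "(?x ^ Suc L - (-1) ^ Suc L * esym {1..N} (Suc L) x) * P
        + (-1) ^ Suc L * (esym {1..N} (Suc L) x * P) \<in> I (Suc L) K"
      by (rule ideal_add[OF is_ideal_I])
    then have "?x ^ Suc L * P \<in> I (Suc L) K"
      by (simp only: left_diff_distrib mult.assoc diff_add_cancel)
    then show "P \<in> I a b" using x_top[of L K P] n eq by simp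
  qed (use n in simp)
  moreover have "hook_ideal x y N L K \<subseteq> ?G 1 1"
    by (rule hook_ideal_Suc_le[OF is_ideal_pair_ideal hook_ideal_le_pair_ideal])
       (use powers_in_pair_ideal(1)[of 1 1] powers_in_pair_ideal(2)[of 1 1] in auto)
  ultimately have start: "P \<in> ?G 1 1" by blast
  have x_steps: "P \<in> ?G a 1" if "1 \<le> a" "a \<le> Suc L" for a
    using that
  proof (induction a rule: dec_induct)
    case base
    show ?case by (rule start)
  next
    case (step a)
    obtain l where l: "L = Suc l" using step by (cases L) auto
    obtain U V where "P - U * ?x ^ a - V * ?y ^ 1 \<in> ?J"
      using step unfolding in_pair_ideal by auto
    then have UV: "P - V * ?y - U * ?x ^ a \<in> ?J"
      by (simp add: diff_diff_eq add.commute)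
    have U: "U \<in> hook_ideal x y N l K"
    proof (rule colon_claimD[OF claim(2)])
      show "N = Suc (Suc (l + K))" using n l by simp
      fix A assume A: "A \<subseteq> {1..N}" "card A = Suc l"
      then have fin: "finite A" "Suc N \<notin> A" using finite_subset by auto
      let ?A = "insert (Suc N) A"
      have A': "?A \<subseteq> {1..Suc N}" "card ?A = Suc L" using A fin l by auto
      have p: "prod x ?A = ?x * prod x A" using fin by simp
      have *: "prod x ?A * P - prod x ?A * (V * ?y) - prod x ?A * U * ?x ^ a \<in> I (Suc L) K"
        using JI[OF UV A'] by (simp only: right_diff_distrib mult.assoc)
      have "prod x ?A * (V * ?y) = (prod x A * V) * (?x * ?y)"
        by (simp add: p mult_ac)
      then have "prod x ?A * (V * ?y) \<in> I (Suc L) K"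
        using sub xy_in_hook_ideal[of x "Suc N" y "Suc N" "Suc L" K] by (metis ideal_mult is_ideal_I subsetD)
      then have "prod x ?A * U * ?x ^ a \<in> I (Suc L) K"
        using ideal_remainder[OF is_ideal_I * kills[OF A']] by blast
      then have "?x ^ (L - a) * (prod x ?A * U * ?x ^ a) \<in> I (Suc L) K"
        by (rule ideal_mult[OF is_ideal_I])
      moreover have "?x ^ Suc L = ?x * (?x ^ (L - a) * ?x ^ a)"
        using step.prems by (simp flip: power_add)
      then have "?x ^ (L - a) * (prod x ?A * U * ?x ^ a) = ?x ^ Suc L * (prod x A * U)"
        by (simp only: p mult_ac)
      ultimately show "prod x A * U \<in> I (Suc l) K"
        using x_top[of L K "prod x A * U"] n l by simp
    qed
    have "?x ^ a * U \<in> ?G (Suc a) 1"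
    proof (rule x_power_times_hook_ideal[OF is_ideal_pair_ideal hook_ideal_le_pair_ideal step.hyps(1) _ _ _ U])
      show "?x ^ Suc a \<in> ?G (Suc a) 1" by (rule powers_in_pair_ideal) simp
      show "L \<le> Suc l" using l by simp
      fix B assume B: "B \<subseteq> {1..N}" "card B = Suc K"
      have "prod y B \<in> ?J" by (rule prod_y_in_hook_ideal) (use B in auto)
      then show "?x ^ a * prod y B \<in> ?G (Suc a) 1"
        using hook_ideal_le_pair_ideal by (intro ideal_mult[OF is_ideal_pair_ideal]) blast
    qed
    then have "U * ?x ^ a \<in> ?G (Suc a) 1" by (simp add: mult.commute)
    moreover have "V * ?y \<in> ?G (Suc a) 1"
      using powers_in_pair_ideal(2)[of 1 1] by (intro ideal_mult[OF is_ideal_pair_ideal]) auto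
    ultimately show ?case
      using ideal_recombine[OF is_ideal_pair_ideal] UV hook_ideal_le_pair_ideal by blast
  qed
  have xJ: "?x ^ Suc L \<in> ?J" by (rule x_power_in_hook_ideal) simp
  have "P \<in> ?G (Suc L) c" if "1 \<le> c" "c \<le> Suc K" for c
    using that
  proof (induction c rule: dec_induct)
    case base
    show ?case by (rule x_steps) auto
  next
    case (step c)
    obtain k where k: "K = Suc k" using step by (cases K) auto
    obtain U V where UV: "P - U * ?x ^ Suc L - V * ?y ^ c \<in> ?J"
      using step unfolding in_pair_ideal by auto
    have V: "V \<in> hook_ideal x y N L k"
    proof (rule colon_claimD[OF claim(2)])
      show "N = Suc (Suc (L + k))" using n k by simp
      fix A assume A: "A \<subseteq> {1..N}" "card A = Suc L"
      then have A': "A \<subseteq> {1..Suc N}" by auto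
      have *: "prod x A * P - prod x A * (U * ?x ^ Suc L) - prod x A * V * ?y ^ c \<in> I (Suc L) K"
        using JI[OF UV A' A(2)] by (simp only: right_diff_distrib mult.assoc)
      have "prod x A * (U * ?x ^ Suc L) \<in> I (Suc L) K"
        by (rule JI[OF _ A' A(2)]) (rule ideal_mult[OF is_ideal_hook_ideal xJ])
      then have "prod x A * V * ?y ^ c \<in> I (Suc L) K"
        using ideal_remainder[OF is_ideal_I * kills[OF A' A(2)]] by blast
      then have "?y ^ (K - c) * (prod x A * V * ?y ^ c) \<in> I (Suc L) K"
        by (rule ideal_mult[OF is_ideal_I])
      moreover have "?y ^ K = ?y ^ (K - c) * ?y ^ c"
        using step.prems by (simp flip: power_add)
      then have "?y ^ (K - c) * (prod x A * V * ?y ^ c) = ?y ^ K * (prod x A * V)"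
        by (simp only: mult_ac)
      ultimately show "prod x A * V \<in> I (Suc L) k"
        using y_top[of "Suc L" k "prod x A * V"] n k by simp
    qed
    have "?y ^ c * V \<in> ?G (Suc L) (Suc c)"
    proof (rule y_power_times_hook_ideal[OF is_ideal_pair_ideal hook_ideal_le_pair_ideal step.hyps(1) _ _ _ V])
      show "?y ^ Suc c \<in> ?G (Suc L) (Suc c)" by (rule powers_in_pair_ideal) simp
      show "K \<le> Suc k" using k by simp
      fix A assume A: "A \<subseteq> {1..N}" "card A = Suc L"
      have "prod x A \<in> ?J" by (rule prod_x_in_hook_ideal) (use A in auto)
      then show "?y ^ c * prod x A \<in> ?G (Suc L) (Suc c)"
        using hook_ideal_le_pair_ideal by (intro ideal_mult[OF is_ideal_pair_ideal]) blast
    qed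
    then have "V * ?y ^ c \<in> ?G (Suc L) (Suc c)" by (simp add: mult.commute)
    moreover have "U * ?x ^ Suc L \<in> ?G (Suc L) (Suc c)"
      by (intro ideal_mult[OF is_ideal_pair_ideal] powers_in_pair_ideal) simp
    ultimately show ?case
      using ideal_recombine[OF is_ideal_pair_ideal] UV hook_ideal_le_pair_ideal by blast
  qed
  from this[of "Suc K"] have "P \<in> ?G (Suc L) (Suc K)" by simp
  moreover have "?y ^ Suc K \<in> ?J" by (rule y_power_in_hook_ideal) simp
  ultimately show "P \<in> ?J"
    using pair_ideal_eq_hook_ideal[OF xJ] by blast
qed

lemma intersection_and_colon_claims: "1 \<le> n \<Longrightarrow> intersection_claim x y I n \<and> colon_claim x y I n"
proof (induction n rule: dec_induct)
  case base
  have "intersection_claim x y I 1"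
    unfolding intersection_claim_def
  proof (intro allI impI)
    fix L K P assume *: "\<forall>a b. a \<le> L \<longrightarrow> b \<le> K \<longrightarrow> Suc (a + b) = 1 \<longrightarrow> P \<in> I a b"
    have "P \<in> hook_ideal x y (Suc 0) (min L 0) (min K 0)"
      using * I_0_0 by (auto simp: One_nat_def)
    then show "P \<in> hook_ideal x y 1 L K"
      using hook_ideal_min[of x y 0 L K] by (auto simp: One_nat_def)
  qed
  moreover have "colon_claim x y I 1"
    unfolding colon_claim_def by (simp add: One_nat_def)
  ultimately show ?case by blast
next
  case (step n)
  then show ?case using intersection_claim_Suc colon_claim_Suc by blast
qed

theorem I_eq_hook_ideal: "I a b = hook_ideal x y (Suc (a + b)) a b"
proof
  show "I a b \<subseteq> hook_ideal x y (Suc (a + b)) a b"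
  proof
    fix P assume P: "P \<in> I a b"
    have "intersection_claim x y I (Suc (a + b))" using intersection_and_colon_claims[of "Suc (a + b)"] by simp
    then show "P \<in> hook_ideal x y (Suc (a + b)) a b"
    proof (rule intersection_claimD)
      fix a' b' assume "a' \<le> a" "b' \<le> b" "Suc (a' + b') = Suc (a + b)"
      then have "a' = a" "b' = b" by auto
      then show "P \<in> I a' b'" using P by simp
    qed simp
  qed
qed (rule hook_ideal_le)

end

section \<open>Contraction and the weight of a hook\<close>

type_synonym expo = "var \<Rightarrow>\<^sub>0 nat"

lemma poly_mapping_induct [case_names zero single add]:
  fixes P :: "'k \<Rightarrow>\<^sub>0 'c::comm_monoid_add"
  assumes "Q 0" "\<And>k. k \<in> Poly_Mapping.keys P \<Longrightarrow> Q (Poly_Mapping.single k (Poly_Mapping.lookup P k))"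
    "\<And>f g. Q f \<Longrightarrow> Q g \<Longrightarrow> Q (f + g)"
  shows "Q P"
proof -
  have P: "P = (\<Sum>k\<in>Poly_Mapping.keys P. Poly_Mapping.single k (Poly_Mapping.lookup P k))"
    by (rule poly_mapping_eqI) (auto simp: lookup_sum lookup_single when_def in_keys_iff)
  have "Q (\<Sum>k\<in>A. Poly_Mapping.single k (Poly_Mapping.lookup P k))" if "A \<subseteq> Poly_Mapping.keys P" for A
    using finite_subset[OF that finite_keys] that by (induction A) (auto intro: assms)
  from this[OF subset_refl] show ?thesis by (subst P)
qed

text \<open>
  The action of polynomials on functions of exponents by shifts, which is what \<open>P(\<partial>)\<close> becomes after
  coefficients are multiplied by factorials of their exponents. Unlike differentiation it involves
  no numerical factors.
\<close>

definition contract :: "mpol \<Rightarrow> (expo \<Rightarrow> rat) \<Rightarrow> expo \<Rightarrow> rat" where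
  "contract P w m = (\<Sum>k\<in>Poly_Mapping.keys P. Poly_Mapping.lookup P k * w (m + k))"

lemma contract_0 [simp]: "contract 0 w = (\<lambda>_. 0)"
  by (simp add: contract_def fun_eq_iff)

lemma contract_weight_0 [simp]: "contract P (\<lambda>_. 0) = (\<lambda>_. 0)"
  by (simp add: contract_def fun_eq_iff)

lemma contract_single: "contract (Poly_Mapping.single k c) w m = c * w (m + k)"
  by (simp add: contract_def)

lemma contract_add: "contract (P + Q) w m = contract P w m + contract Q w m"
  unfolding contract_def
  by (rule setsum_keys_plus_distrib) (simp_all add: distrib_right)

lemma contract_sum: "contract (\<Sum>i\<in>A. P i) w m = (\<Sum>i\<in>A. contract (P i) w m)"
  by (induction A rule: infinite_finite_induct) (simp_all add: contract_add)

lemma contract_scaled_weight: "contract P (\<lambda>m. c * w m) m = c * contract P w m"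
  by (simp add: contract_def sum_distrib_left mult_ac)

text \<open>
  Hence the weights form a module, and annihilators are ideals.
\<close>

lemma contract_mult: "contract (P * Q) w = contract P (contract Q w)"
proof
  fix m
  have *: "contract (Poly_Mapping.single k c * Q) w m = c * contract Q w (m + k)" for k c
  proof (induction Q rule: poly_mapping_induct)
    case (add f g)
    then show ?case by (simp add: distrib_left contract_add)
  qed (simp_all add: mult_single contract_single add.assoc)
  show "contract (P * Q) w m = contract P (contract Q w) m"
  proof (induction P rule: poly_mapping_induct)
    case (add f g)
    then show ?case by (simp add: distrib_right contract_add)
  qed (simp_all add: * contract_single)
qed

lemma Var_power: "Var v ^ k = Poly_Mapping.single (Poly_Mapping.single v k) 1"
  by (induction k) (simp_all add: Var_def mult_single plus_1_eq_Suc flip: single_add)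

lemma prod_single:
  "finite A \<Longrightarrow> (\<Prod>i\<in>A. Poly_Mapping.single (f i) 1) = (Poly_Mapping.single (\<Sum>i\<in>A. f i) 1 :: mpol)"
  by (induction A rule: finite_induct) (simp_all add: mult_single)

lemma prod_Var:
  "finite A \<Longrightarrow> (\<Prod>i\<in>A. Var (z i)) = Poly_Mapping.single (\<Sum>i\<in>A. Poly_Mapping.single (z i) 1) 1"
  by (simp add: Var_def prod_single)

lemma prod_mset_Var:
  "(\<Prod>i\<in>#M. Var (z i)) = Poly_Mapping.single (\<Sum>i\<in>#M. Poly_Mapping.single (z i) 1) 1"
  by (induction M) (simp_all add: Var_def mult_single)

definition signed_exp :: "expo \<Rightarrow> nat \<Rightarrow> int" where
  "signed_exp m i = int (Poly_Mapping.lookup m (X i)) - int (Poly_Mapping.lookup m (Y i))"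

text \<open>
  The shift by \<open>b + 1\<close> moves \<open>{-b..n - 1 - b}\<close> to \<open>{1..n}\<close>. Values below the range become \<open>0\<close> and so
  are excluded together with those above it by asking for a permutation of \<open>{1..n}\<close>.
\<close>

definition hook_perm :: "nat \<Rightarrow> nat \<Rightarrow> expo \<Rightarrow> nat \<Rightarrow> nat" where
  "hook_perm n b m i = (if i \<in> {1..n} then nat (signed_exp m i + int b + 1) else i)"

definition unmixed :: "nat \<Rightarrow> expo \<Rightarrow> bool" where
  "unmixed n m \<longleftrightarrow> (\<forall>i. Poly_Mapping.lookup m (X i) = 0 \<or> Poly_Mapping.lookup m (Y i) = 0)
     \<and> (\<forall>i. i \<notin> {1..n} \<longrightarrow> Poly_Mapping.lookup m (X i) = 0 \<and> Poly_Mapping.lookup m (Y i) = 0)"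

definition hook_weight :: "nat \<Rightarrow> nat \<Rightarrow> expo \<Rightarrow> rat" where
  "hook_weight n b m =
     (if unmixed n m \<and> hook_perm n b m permutes {1..n} then of_int (sign (hook_perm n b m)) else 0)"

lemma unmixed_add: "unmixed n (m + k) \<Longrightarrow> unmixed n m"
  by (auto simp: unmixed_def lookup_add)

lemma permutes_Suc_iff:
  assumes "p (Suc N) = Suc N"
  shows "p permutes {1..Suc N} \<longleftrightarrow> p permutes {1..N}"
proof
  assume p: "p permutes {1..Suc N}"
  show "p permutes {1..N}"
    by (rule permutes_superset[OF p]) (use assms in \<open>auto simp: le_Suc_eq\<close>)
next
  assume "p permutes {1..N}"
  then show "p permutes {1..Suc N}" by (rule permutes_subset) auto
qed

text \<open>
  Shifting by the top power forces the last signed exponent to be maximal; the last point is then fixed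
  by the permutation and can be dropped.
\<close>

lemma contract_x_top:
  "contract (Var (X (Suc (Suc (a + b)))) ^ Suc a) (hook_weight (Suc (Suc (a + b))) b)
     = hook_weight (Suc (a + b)) b"
proof
  fix m
  define N where "N = Suc (a + b)"
  define k :: expo where "k = Poly_Mapping.single (X (Suc N)) (Suc a)"
  have lk: "Poly_Mapping.lookup (m + k) (X i) = Poly_Mapping.lookup m (X i) + (if i = Suc N then Suc a else 0)"
    "Poly_Mapping.lookup (m + k) (Y i) = Poly_Mapping.lookup m (Y i)" for i
    by (simp_all add: k_def lookup_add lookup_single when_def)
  have "hook_weight (Suc N) b (m + k) = hook_weight N b m"
  proof (cases "unmixed N m")
    case True
    then have 0: "Poly_Mapping.lookup m (X (Suc N)) = 0" "Poly_Mapping.lookup m (Y (Suc N)) = 0"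
      by (auto simp: unmixed_def)
    have u: "unmixed (Suc N) (m + k)"
      using True 0 by (auto simp: unmixed_def lk)
    have p: "hook_perm (Suc N) b (m + k) = hook_perm N b m"
    proof
      fix i
      show "hook_perm (Suc N) b (m + k) i = hook_perm N b m i"
        using 0 by (cases "i = Suc N") (auto simp: hook_perm_def signed_exp_def lk N_def)
    qed
    have "hook_perm N b m (Suc N) = Suc N" by (simp add: hook_perm_def)
    from permutes_Suc_iff[of "hook_perm N b m", OF this] show ?thesis
      using True u by (simp add: hook_weight_def p)
  next
    case False
    have "\<not> (unmixed (Suc N) (m + k) \<and> hook_perm (Suc N) b (m + k) permutes {1..Suc N})"
    proof
      assume *: "unmixed (Suc N) (m + k) \<and> hook_perm (Suc N) b (m + k) permutes {1..Suc N}"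
      then have Y0: "Poly_Mapping.lookup m (Y (Suc N)) = 0"
        by (auto simp: unmixed_def lk dest: spec[of _ "Suc N"])
      have "hook_perm (Suc N) b (m + k) (Suc N) \<in> {1..Suc N}"
        using * by (subst permutes_in_image[of _ "{1..Suc N}"]) auto
      then have X0: "Poly_Mapping.lookup m (X (Suc N)) = 0"
        using Y0 by (auto simp: hook_perm_def signed_exp_def lk N_def nat_le_iff)
      have "unmixed N m"
        using * X0 Y0 unfolding unmixed_def lk by (metis atLeastAtMost_iff le_SucE add_eq_0_iff_both_eq_0)
      then show False using False by simp
    qed
    then show ?thesis using False by (simp add: hook_weight_def)
  qed
  then show "contract (Var (X (Suc (Suc (a + b)))) ^ Suc a) (hook_weight (Suc (Suc (a + b))) b) m
     = hook_weight (Suc (a + b)) b m"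
    by (simp add: Var_power contract_single N_def k_def del: power_Suc)
qed

lemma nat_pred_bounds:
  fixes s :: int
  assumes "1 < nat (s + int b + 2)" "nat (s + int b + 2) \<le> Suc N"
  shows "1 \<le> nat (s + int b + 1) \<and> nat (s + int b + 1) \<le> N"
  using assms by auto

text \<open>
  Here the last index goes to \<open>1\<close>. Dropping it lowers the other values by one, which composes the
  permutation with a fixed cycle \<open>q\<close>.
\<close>

lemma contract_y_top:
  "\<exists>c \<noteq> 0. \<forall>m. contract (Var (Y (Suc (Suc (a + b)))) ^ Suc b) (hook_weight (Suc (Suc (a + b))) (Suc b)) m
     = c * hook_weight (Suc (a + b)) b m"
proof -
  define N where "N = Suc (a + b)"
  define k :: expo where "k = Poly_Mapping.single (Y (Suc N)) (Suc b)"
  define q where "q i = (if i \<in> {1..N} then Suc i else if i = Suc N then 1 else i)" for i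
  have q: "q permutes {1..Suc N}"
    unfolding q_def by (rule inj_imp_permutes) (auto simp: inj_on_def split: if_splits)
  have perm_q: "permutation q" using q permutation_permutes by blast
  have "hook_weight (Suc N) (Suc b) (m + k) = of_int (sign q) * hook_weight N b m" for m
  proof -
    have lk: "Poly_Mapping.lookup (m + k) (Y i) = Poly_Mapping.lookup m (Y i) + (if i = Suc N then Suc b else 0)"
      "Poly_Mapping.lookup (m + k) (X i) = Poly_Mapping.lookup m (X i)" for i
      by (simp_all add: k_def lookup_add lookup_single when_def)
    let ?p = "hook_perm N b m" and ?p' = "hook_perm (Suc N) (Suc b) (m + k)"
    have top: "Poly_Mapping.lookup m (X (Suc N)) = 0 \<and> Poly_Mapping.lookup m (Y (Suc N)) = 0"
      if "unmixed (Suc N) (m + k)" "?p' permutes {1..Suc N}"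
    proof -
      have X0: "Poly_Mapping.lookup m (X (Suc N)) = 0"
        using that by (auto simp: unmixed_def lk dest: spec[of _ "Suc N"])
      moreover have "1 \<le> ?p' (Suc N)"
        using permutes_in_image[OF that(2), of "Suc N"] by simp
      ultimately show ?thesis
        by (cases "Poly_Mapping.lookup m (Y (Suc N))") (auto simp: hook_perm_def signed_exp_def lk)
    qed
    show ?thesis
    proof (cases "unmixed N m")
      case False
      have "\<not> (unmixed (Suc N) (m + k) \<and> ?p' permutes {1..Suc N})"
      proof
        assume *: "unmixed (Suc N) (m + k) \<and> ?p' permutes {1..Suc N}"
        then have "unmixed N m"
          using top unmixed_add[of "Suc N" m k] unfolding unmixed_def
          by (metis atLeastAtMost_iff le_Suc_eq)
        then show False using False by simp
      qed
      then show ?thesis using False by (simp add: hook_weight_def)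
    next
      case True
      then have 0: "Poly_Mapping.lookup m (X (Suc N)) = 0" "Poly_Mapping.lookup m (Y (Suc N)) = 0"
        by (auto simp: unmixed_def)
      have u: "unmixed (Suc N) (m + k)"
        using True 0 by (auto simp: unmixed_def lk)
      have p'_top: "?p' (Suc N) = 1" using 0 by (simp add: hook_perm_def signed_exp_def lk)
      have p_top: "?p (Suc N) = Suc N" by (simp add: hook_perm_def)
      have p'_eq: "?p' i = nat (signed_exp m i + int b + 2)" "?p i = nat (signed_exp m i + int b + 1)"
        if "i \<in> {1..N}" for i
        using that by (auto simp: hook_perm_def signed_exp_def lk)
      show ?thesis
      proof (cases "\<forall>i\<in>{1..N}. ?p i \<in> {1..N}")
        case True
        have qp: "q \<circ> ?p = ?p'"
        proof
          fix i
          consider "i \<in> {1..N}" | "i = Suc N" | "i \<notin> {1..Suc N}" by fastforce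
          then show "(q \<circ> ?p) i = ?p' i"
          proof cases
            case 1
            then have "?p i \<in> {1..N}" using True by blast
            then have "q (?p i) = Suc (?p i)" by (simp add: q_def)
            also have "\<dots> = ?p' i"
              using \<open>?p i \<in> {1..N}\<close> unfolding p'_eq[OF 1] atLeastAtMost_iff by arith
            finally show ?thesis by simp
          next
            case 2
            then show ?thesis by (simp add: p_top p'_top q_def)
          next
            case 3
            then show ?thesis by (auto simp: hook_perm_def q_def)
          qed
        qed
        have iff: "?p' permutes {1..Suc N} \<longleftrightarrow> ?p permutes {1..N}"
        proof
          assume "?p' permutes {1..Suc N}"
          then have "inv_into UNIV q \<circ> (q \<circ> ?p) permutes {1..Suc N}"
            using permutes_inv[OF q] qp by (auto intro: permutes_compose)
          then have "?p permutes {1..Suc N}"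
            using permutes_inv_o(2)[OF q] by (simp add: o_assoc)
          then show "?p permutes {1..N}" using permutes_Suc_iff[of ?p, OF p_top] by simp
        next
          assume "?p permutes {1..N}"
          then have "?p permutes {1..Suc N}" using permutes_Suc_iff[of ?p, OF p_top] by simp
          then show "?p' permutes {1..Suc N}" unfolding qp[symmetric] by (rule permutes_compose[OF _ q])
        qed
        have "sign ?p' = sign q * sign ?p" if "?p permutes {1..N}"
          unfolding qp[symmetric] using that perm_q permutation_permutes[of ?p]
          by (intro sign_compose) auto
        then show ?thesis using u iff \<open>unmixed N m\<close> by (simp add: hook_weight_def)
      next
        case False
        then have "\<not> ?p permutes {1..N}" by (metis permutes_in_image)
        moreover have "\<not> ?p' permutes {1..Suc N}"
        proof
          assume p': "?p' permutes {1..Suc N}"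
          have "?p i \<in> {1..N}" if i: "i \<in> {1..N}" for i
          proof -
            have "?p' i \<in> {1..Suc N}" using permutes_in_image[OF p', of i] i by auto
            moreover have "i \<noteq> Suc N" using i by auto
            then have "?p' i \<noteq> ?p' (Suc N)" by (simp add: inj_eq[OF permutes_inj[OF p']])
            ultimately have p'_i: "1 < ?p' i" "?p' i \<le> Suc N"
              unfolding p'_top by simp_all
            then show ?thesis
              unfolding p'_eq[OF i] atLeastAtMost_iff by (rule nat_pred_bounds)
          qed
          then show False using False by metis
        qed
        ultimately show ?thesis by (simp add: hook_weight_def)
      qed
    qed
  qed
  then show ?thesis
    by (intro exI[of _ "of_int (sign q)"])
       (simp add: Var_power contract_single N_def k_def del: power_Suc)
qed


lemma hook_weight_swap:
  assumes "j \<in> {1..n}" "k \<in> {1..n}" "j \<noteq> k"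
    and "\<And>i. Poly_Mapping.lookup m' (X i) = Poly_Mapping.lookup m (X (Transposition.transpose j k i))"
    and "\<And>i. Poly_Mapping.lookup m' (Y i) = Poly_Mapping.lookup m (Y (Transposition.transpose j k i))"
  shows "hook_weight n b m' = - hook_weight n b m"
proof -
  let ?t = "Transposition.transpose j k"
  have t: "?t permutes {1..n}" using assms by (intro permutes_swap_id)
  have t_in: "?t i \<in> {1..n} \<longleftrightarrow> i \<in> {1..n}" for i by (rule permutes_in_image[OF t])
  have "unmixed n m' \<longleftrightarrow> unmixed n m"
  proof
    show "unmixed n m'" if "unmixed n m"
      using that by (simp add: unmixed_def assms(4,5) t_in del: atLeastAtMost_iff)
    show "unmixed n m" if "unmixed n m'"
    proof -
      have "Poly_Mapping.lookup m (X i) = Poly_Mapping.lookup m' (X (?t i))"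
        "Poly_Mapping.lookup m (Y i) = Poly_Mapping.lookup m' (Y (?t i))" for i
        by (simp_all add: assms(4,5))
      then show ?thesis using that t_in unfolding unmixed_def by metis
    qed
  qed
  moreover have p: "hook_perm n b m' = hook_perm n b m \<circ> ?t"
  proof
    fix i
    have "?t i = i" if "i \<notin> {1..n}" using that by (rule permutes_not_in[OF t])
    then show "hook_perm n b m' i = (hook_perm n b m \<circ> ?t) i"
      using t_in[of i] by (simp add: hook_perm_def signed_exp_def assms(4,5))
  qed
  moreover have "(hook_perm n b m \<circ> ?t) permutes {1..n} \<longleftrightarrow> hook_perm n b m permutes {1..n}"
  proof
    assume "(hook_perm n b m \<circ> ?t) permutes {1..n}"
    from permutes_compose[OF t this] show "hook_perm n b m permutes {1..n}"
      by (simp add: comp_assoc)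
  qed (rule permutes_compose[OF t])
  moreover have "sign (hook_perm n b m \<circ> ?t) = - sign (hook_perm n b m)" if "hook_perm n b m permutes {1..n}"
    using that permutation_permutes[of "hook_perm n b m"] permutation_swap_id assms(3)
    by (subst sign_compose) (auto simp: sign_swap_id)
  ultimately show ?thesis by (simp add: hook_weight_def)
qed

definition mset_expo :: "(nat \<Rightarrow> var) \<Rightarrow> nat multiset \<Rightarrow> expo" where
  "mset_expo z M = (\<Sum>i\<in>#M. Poly_Mapping.single (z i) 1)"

lemma lookup_mset_expo: "inj z \<Longrightarrow> Poly_Mapping.lookup (mset_expo z M) (z i) = count M i"
  by (induction M) (auto simp: mset_expo_def lookup_add lookup_single when_def inj_eq)

lemma lookup_mset_expo_0: "v \<notin> range z \<Longrightarrow> Poly_Mapping.lookup (mset_expo z M) v = 0"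
  by (induction M) (auto simp: mset_expo_def lookup_add lookup_single when_def)

lemma contract_hsym:
  "contract (hsym T k (\<lambda>i. Var (z i))) w m = (\<Sum>M\<in>multisets_of_size T k. w (m + mset_expo z M))"
  unfolding hsym_def contract_sum prod_mset_Var by (simp add: contract_single mset_expo_def)

text \<open>
  A nonzero term means that raising some signed exponents of \<open>m\<close> in the same direction, by \<open>k\<close> in total,
  yields an arrangement of the full range. The exponents of \<open>m\<close> lie in that range too, but
  have another sum, so two of them coincide. Exchanging these two indices changes the sign of all terms
  while it only permutes the sum.
\<close>

lemma contract_hsym_hook_weight:
  assumes z: "z = X \<or> z = Y" and k: "1 \<le> k" and b: "b < n"
  shows "contract (hsym {1..n} k (\<lambda>i. Var (z i))) (hook_weight n b) m = 0"
proof (rule ccontr)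
  have inj: "inj z" using z by (auto intro: injI)
  let ?f = "\<Sum>M\<in>multisets_of_size {1..n} k. hook_weight n b (m + mset_expo z M)"
  assume "contract (hsym {1..n} k (\<lambda>i. Var (z i))) (hook_weight n b) m \<noteq> 0"
  then have f: "?f \<noteq> 0" by (simp add: contract_hsym)
  then obtain M where M: "M \<in> multisets_of_size {1..n} k" "hook_weight n b (m + mset_expo z M) \<noteq> 0"
    by (meson sum.neutral)
  let ?m = "m + mset_expo z M"
  have u: "unmixed n ?m" and p: "hook_perm n b ?m permutes {1..n}"
    using M(2) by (auto simp: hook_weight_def split: if_splits)
  have lkX: "Poly_Mapping.lookup (mset_expo z M') (X i) = (if z = X then count M' i else 0)" for M' i
    using z lookup_mset_expo[OF inj, of M' i] lookup_mset_expo_0[of "X i" z M'] by auto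
  have lkY: "Poly_Mapping.lookup (mset_expo z M') (Y i) = (if z = Y then count M' i else 0)" for M' i
    using z lookup_mset_expo[OF inj, of M' i] lookup_mset_expo_0[of "Y i" z M'] by auto
  have XY: "X \<noteq> Y" by (metis var.distinct(1))
  define s :: int where "s = (if z = X then 1 else -1)"
  have se: "signed_exp ?m i = signed_exp m i + s * int (count M i)" for i
    using z XY by (auto simp: signed_exp_def lookup_add lkX lkY s_def)
  \<comment> \<open>If \<open>z i\<close> is raised, the other variable of index \<open>i\<close> has exponent zero, so the signed exponent in \<open>m\<close> lies between \<open>0\<close> and the one in \<open>?m\<close>.\<close>
  have range: "signed_exp m i + int b + 1 \<in> {1..int n}" if i: "i \<in> {1..n}" for i
  proof -
    have "hook_perm n b ?m i \<in> {1..n}" using permutes_in_image[OF p, of i] i by simp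
    then have r: "signed_exp ?m i + int b + 1 \<in> {1..int n}"
      using i by (auto simp: hook_perm_def)
    have "Poly_Mapping.lookup ?m (X i) = 0 \<or> Poly_Mapping.lookup ?m (Y i) = 0"
      using u by (auto simp: unmixed_def)
    then show ?thesis
      using r z b XY by (auto simp: signed_exp_def lookup_add lkX lkY)
  qed
  have "\<not> inj_on (hook_perm n b m) {1..n}"
  proof
    assume inj': "inj_on (hook_perm n b m) {1..n}"
    have "hook_perm n b m ` {1..n} \<subseteq> {1..n}"
      using range by (fastforce simp: hook_perm_def)
    then have "hook_perm n b m ` {1..n} = {1..n}"
      using inj' by (intro endo_inj_surj) auto
    then have "(\<Sum>i\<in>{1..n}. hook_perm n b m i) = \<Sum>{1..n}"
      using sum.reindex[OF inj', of id] by simp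
    also have "\<dots> = (\<Sum>i\<in>{1..n}. hook_perm n b ?m i)"
      using sum.permute[OF p, of id] by simp
    finally have eq: "int (\<Sum>i\<in>{1..n}. hook_perm n b m i) = int (\<Sum>i\<in>{1..n}. hook_perm n b ?m i)"
      by simp
    have "int (hook_perm n b m i) = signed_exp m i + int b + 1"
      "int (hook_perm n b ?m i) = signed_exp m i + int b + 1 + s * int (count M i)" if "i \<in> {1..n}" for i
    proof -
      show "int (hook_perm n b m i) = signed_exp m i + int b + 1"
        using range[OF that] that by (simp add: hook_perm_def)
      have "hook_perm n b ?m i \<in> {1..n}" using permutes_in_image[OF p, of i] that by simp
      then show "int (hook_perm n b ?m i) = signed_exp m i + int b + 1 + s * int (count M i)"
        using that by (auto simp: hook_perm_def se)
    qed
    then have "(\<Sum>i\<in>{1..n}. s * int (count M i)) = 0"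
      using eq by (simp add: sum.distrib)
    then have "(\<Sum>i\<in>{1..n}. int (count M i)) = 0"
      by (simp add: s_def flip: sum_distrib_left split: if_splits)
    then have "\<forall>i\<in>{1..n}. count M i = 0"
      by (simp flip: of_nat_sum)
    moreover have "set_mset M \<subseteq> {1..n}" "size M = k" using M by (auto simp: multisets_of_size_def)
    ultimately have "M = {#}" by (metis count_greater_zero_iff less_numeral_extra(3) multiset_nonemptyE subsetD)
    then show False using \<open>size M = k\<close> k by simp
  qed
  then obtain j l where jl: "j \<in> {1..n}" "l \<in> {1..n}" "j \<noteq> l" "hook_perm n b m j = hook_perm n b m l"
    by (auto simp: inj_on_def)
  then have eq: "signed_exp m j = signed_exp m l"
    using range[of j] range[of l] by (auto simp: hook_perm_def)
  have "unmixed n m" using unmixed_add[OF u] .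
  then have same: "Poly_Mapping.lookup m (X j) = Poly_Mapping.lookup m (X l)"
      "Poly_Mapping.lookup m (Y j) = Poly_Mapping.lookup m (Y l)"
    using eq unfolding unmixed_def signed_exp_def by (metis diff_0 diff_0_right int_eq_iff neg_equal_iff_equal of_nat_0 of_nat_0_le_iff of_nat_eq_iff neg_0_le_iff_le antisym)+
  let ?t = "Transposition.transpose j l"
  have t: "?t permutes {1..n}" using jl by (intro permutes_swap_id)
  have lk_t: "Poly_Mapping.lookup m (X (?t i)) = Poly_Mapping.lookup m (X i)"
    "Poly_Mapping.lookup m (Y (?t i)) = Poly_Mapping.lookup m (Y i)" for i
    using same by (auto simp: Transposition.transpose_def)
  have count_t: "count (image_mset ?t M') i = count M' (?t i)" for M' i
  proof (induction M')
    case (add x M')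
    have "?t x = i \<longleftrightarrow> x = ?t i" by (metis transpose_involutory)
    then show ?case using add by auto
  qed simp
  have bij: "bij_betw (image_mset ?t) (multisets_of_size {1..n} k) (multisets_of_size {1..n} k)"
  proof (rule bij_betwI[where g = "image_mset ?t"])
    show "image_mset ?t \<in> multisets_of_size {1..n} k \<rightarrow> multisets_of_size {1..n} k"
      by (auto simp: multisets_of_size_def subset_iff permutes_in_image[OF t] simp del: atLeastAtMost_iff)
    then show "image_mset ?t \<in> multisets_of_size {1..n} k \<rightarrow> multisets_of_size {1..n} k" .
  qed (simp_all add: image_mset.compositionality comp_def)
  have "?f = (\<Sum>M\<in>multisets_of_size {1..n} k. hook_weight n b (m + mset_expo z (image_mset ?t M)))"
    by (rule sum.reindex_bij_betw[OF bij, symmetric])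
  also have "\<dots> = (\<Sum>M\<in>multisets_of_size {1..n} k. - hook_weight n b (m + mset_expo z M))"
    by (rule sum.cong[OF refl], rule hook_weight_swap[OF jl(1-3)])
       (simp_all add: lookup_add lkX lkY lk_t count_t)
  finally have "?f = - ?f" by (simp add: sum_negf)
  then show False using f by simp
qed


lemma contract_single_eq_0:
  "(\<And>m. w (m + k) = 0) \<Longrightarrow> contract (Poly_Mapping.single k c) w = (\<lambda>_. 0)"
  by (simp add: fun_eq_iff contract_single)

text \<open>
  Exactly \<open>n - 1 - b\<close> values of the range are positive and \<open>b\<close> are negative, so there is no room for more
  indices with a factor \<open>x\<^sub>i\<close>, or \<open>y\<^sub>i\<close>.
\<close>

lemma hook_weight_prod_eq_0:
  assumes z: "z = X \<and> n \<le> b + card A \<or> z = Y \<and> b < card A" and A: "A \<subseteq> {1..n}" and b: "b < n"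
  shows "hook_weight n b (m + (\<Sum>i\<in>A. Poly_Mapping.single (z i) 1)) = 0"
proof (rule ccontr)
  let ?m = "m + (\<Sum>i\<in>A. Poly_Mapping.single (z i) 1)"
  assume "hook_weight n b ?m \<noteq> 0"
  then have u: "unmixed n ?m" and p: "hook_perm n b ?m permutes {1..n}"
    by (auto simp: hook_weight_def split: if_splits)
  have fin: "finite A" using A finite_subset by blast
  have 1: "1 \<le> Poly_Mapping.lookup ?m (z i)" if "i \<in> A" for i
  proof -
    have "(\<Sum>j\<in>A. Poly_Mapping.lookup (Poly_Mapping.single (z j) (1::nat)) (z i)) \<ge> 1"
      using member_le_sum[OF that, of "\<lambda>j. Poly_Mapping.lookup (Poly_Mapping.single (z j) (1::nat)) (z i)"] fin
      by simp
    then show ?thesis by (simp add: lookup_add lookup_sum)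
  qed
  have mixed: "Poly_Mapping.lookup ?m (X i) = 0 \<or> Poly_Mapping.lookup ?m (Y i) = 0" for i
    using u by (auto simp: unmixed_def)
  have inj: "inj_on (hook_perm n b ?m) A"
    using permutes_inj[OF p] by (simp add: inj_on_def inj_def)
  have range: "hook_perm n b ?m i \<in> {1..n}" if "i \<in> A" for i
    using permutes_in_image[OF p, of i] that A by auto
  show False
  proof (cases "z = X")
    case True
    have "hook_perm n b ?m ` A \<subseteq> {b + 2..n}"
    proof
      fix v assume "v \<in> hook_perm n b ?m ` A"
      then obtain i where i: "i \<in> A" "v = hook_perm n b ?m i" by blast
      then have "1 \<le> signed_exp ?m i"
        using 1[of i] mixed[of i] True by (auto simp: signed_exp_def)
      then have "int b + 2 \<le> int (hook_perm n b ?m i)"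
        using i A by (auto simp: hook_perm_def)
      then show "v \<in> {b + 2..n}" using range[of i] i by simp
    qed
    then have "card A \<le> card {b + 2..n}"
      using card_image[OF inj] card_mono by (metis finite_atLeastAtMost)
    then show False using z True b by (auto dest: fun_cong)
  next
    case False
    have "hook_perm n b ?m ` A \<subseteq> {1..b}"
    proof
      fix v assume "v \<in> hook_perm n b ?m ` A"
      then obtain i where i: "i \<in> A" "v = hook_perm n b ?m i" by blast
      then have "signed_exp ?m i \<le> - 1"
        using 1[of i] mixed[of i] False z by (auto simp: signed_exp_def)
      then have "int (hook_perm n b ?m i) \<le> int b"
        using i A by (auto simp: hook_perm_def)
      then show "v \<in> {1..b}" using range[of i] i by simp
    qed
    then have "card A \<le> card {1..b}"
      using card_image[OF inj] card_mono by (metis finite_atLeastAtMost)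
    then show False using z False by simp
  qed
qed

lemma var_in_hook_ideal_1: "Var v \<in> hook_ideal (\<lambda>i. Var (X i)) (\<lambda>i. Var (Y i)) 1 0 0"
proof (cases v)
  case (X i)
  show ?thesis
  proof (cases "i = 1")
    case True
    then show ?thesis
      using hsym_in_hook_ideal(1)[of 1 1 "\<lambda>i. Var (X i)" "\<lambda>i. Var (Y i)" 0 0] X
      by (simp add: hsym_singleton)
  next
    case False
    then show ?thesis
      using outside_in_hook_ideal(1)[of i 1 "\<lambda>i. Var (X i)"] X by simp
  qed
next
  case (Y i)
  show ?thesis
  proof (cases "i = 1")
    case True
    then show ?thesis
      using hsym_in_hook_ideal(2)[of 1 1 "\<lambda>i. Var (Y i)" "\<lambda>i. Var (X i)" 0 0] Y
      by (simp add: hsym_singleton)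
  next
    case False
    then show ?thesis
      using outside_in_hook_ideal(2)[of i 1 "\<lambda>i. Var (Y i)"] Y by simp
  qed
qed

lemma hook_weight_1: "hook_weight 1 0 k = (if k = 0 then 1 else 0)"
proof (cases "k = 0")
  case True
  have "hook_perm 1 0 0 = id" by (auto simp: fun_eq_iff hook_perm_def signed_exp_def)
  then show ?thesis using True by (simp add: hook_weight_def unmixed_def)
next
  case False
  have "\<not> (unmixed 1 k \<and> hook_perm 1 0 k permutes {1..1})"
  proof
    assume *: "unmixed 1 k \<and> hook_perm 1 0 k permutes {1..1}"
    then have "hook_perm 1 0 k 1 = 1" using permutes_in_image[of "hook_perm 1 0 k" "{1..1}" 1] by simp
    then have "signed_exp k 1 = 0" by (simp add: hook_perm_def)
    then have "Poly_Mapping.lookup k (X i) = 0 \<and> Poly_Mapping.lookup k (Y i) = 0" for i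
      using * by (cases "i = 1") (auto simp: unmixed_def signed_exp_def dest: spec[of _ 1])
    then have "Poly_Mapping.lookup k v = 0" for v by (cases v) auto
    then show False using False by (auto intro: poly_mapping_eqI)
  qed
  then show ?thesis using False by (simp add: hook_weight_def)
qed

lemma no_const_term_in_hook_ideal_1:
  assumes "Poly_Mapping.lookup P 0 = 0"
  shows "P \<in> hook_ideal (\<lambda>i. Var (X i)) (\<lambda>i. Var (Y i)) 1 0 0" (is "_ \<in> ?J")
proof (induction P rule: poly_mapping_induct)
  case zero
  show ?case by (simp add: ideals.subspace_0)
next
  case (add f g)
  then show ?case by (simp add: ideal_add)
next
  case (single k)
  then have "k \<noteq> 0" using assms by (auto simp: in_keys_iff)
  then obtain v where v: "Poly_Mapping.lookup k v \<noteq> 0"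
    by (metis lookup_zero poly_mapping_eqI)
  have "k = (k - Poly_Mapping.single v 1) + Poly_Mapping.single v 1"
    using v by (intro poly_mapping_eqI) (auto simp: lookup_add lookup_minus lookup_single when_def)
  then have "Poly_Mapping.single k (Poly_Mapping.lookup P k)
      = Poly_Mapping.single (k - Poly_Mapping.single v 1) (Poly_Mapping.lookup P k) * Var v"
    by (simp add: Var_def mult_single)
  then show ?case using ideal_mult[OF is_ideal_hook_ideal var_in_hook_ideal_1] by simp
qed

definition hook_kernel :: "nat \<Rightarrow> nat \<Rightarrow> mpol set" where
  "hook_kernel a b = {P. contract P (hook_weight (Suc (a + b)) b) = (\<lambda>_. 0)}"

lemma is_ideal_hook_kernel: "is_ideal (hook_kernel a b)"
proof (rule ideals.subspaceI)
  fix P Q assume "P \<in> hook_kernel a b" "Q \<in> hook_kernel a b"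
  then show "P + Q \<in> hook_kernel a b" by (simp add: hook_kernel_def contract_add fun_eq_iff)
qed (simp_all add: hook_kernel_def contract_mult)

interpretation hook: hook_ideals "\<lambda>i. Var (X i)" "\<lambda>i. Var (Y i)" hook_kernel
proof
  fix a b :: nat and P :: mpol
  show "is_ideal (hook_kernel a b)" by (rule is_ideal_hook_kernel)
  show "Var (X (Suc (Suc (a + b)))) ^ Suc a * P \<in> hook_kernel (Suc a) b \<longleftrightarrow> P \<in> hook_kernel a b"
    unfolding hook_kernel_def mem_Collect_eq mult.commute[of _ P] contract_mult
    using contract_x_top[of a b] by simp
  obtain c where c: "c \<noteq> 0" "\<And>m. contract (Var (Y (Suc (Suc (a + b)))) ^ Suc b) (hook_weight (Suc (Suc (a + b))) (Suc b)) m
     = c * hook_weight (Suc (a + b)) b m"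
    using contract_y_top by blast
  then have eq: "contract (Var (Y (Suc (Suc (a + b)))) ^ Suc b) (hook_weight (Suc (Suc (a + b))) (Suc b))
     = (\<lambda>m. c * hook_weight (Suc (a + b)) b m)" by blast
  then show "Var (Y (Suc (Suc (a + b)))) ^ Suc b * P \<in> hook_kernel a (Suc b) \<longleftrightarrow> P \<in> hook_kernel a b"
    unfolding hook_kernel_def mem_Collect_eq mult.commute[of _ P] contract_mult add_Suc_right eq
    using c(1) by (simp add: fun_eq_iff contract_scaled_weight)
  show "hook_ideal (\<lambda>i. Var (X i)) (\<lambda>i. Var (Y i)) (Suc (a + b)) a b \<subseteq> hook_kernel a b"
  proof (rule hook_ideal_leI)
    show "is_ideal (hook_kernel a b)" by (rule is_ideal_hook_kernel)
    show "hsym {1..Suc (a + b)} i (\<lambda>i. Var (X i)) \<in> hook_kernel a b" if "1 \<le> i" for i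
      using contract_hsym_hook_weight[of X i b "Suc (a + b)"] that by (simp add: hook_kernel_def fun_eq_iff)
    show "hsym {1..Suc (a + b)} i (\<lambda>i. Var (Y i)) \<in> hook_kernel a b" if "1 \<le> i" for i
      using contract_hsym_hook_weight[of Y i b "Suc (a + b)"] that by (simp add: hook_kernel_def fun_eq_iff)
    show "Var (X i) * Var (Y i) \<in> hook_kernel a b" for i
    proof -
      have "\<not> unmixed (Suc (a + b)) (m + (Poly_Mapping.single (X i) 1 + Poly_Mapping.single (Y i) 1))" for m
        unfolding unmixed_def by (auto simp: lookup_add intro!: exI[of _ i])
      then show ?thesis
        unfolding hook_kernel_def Var_def mult_single mem_Collect_eq
        by (intro contract_single_eq_0) (simp add: hook_weight_def)
    qed
    show "(\<Prod>i\<in>A. Var (X i)) \<in> hook_kernel a b" if A: "A \<subseteq> {1..Suc (a + b)}" "card A = Suc a" for A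
      unfolding hook_kernel_def mem_Collect_eq prod_Var[OF finite_subset[OF A(1) finite_atLeastAtMost]]
      by (intro contract_single_eq_0 hook_weight_prod_eq_0) (use A in auto)
    show "(\<Prod>i\<in>A. Var (Y i)) \<in> hook_kernel a b" if A: "A \<subseteq> {1..Suc (a + b)}" "card A = Suc b" for A
      unfolding hook_kernel_def mem_Collect_eq prod_Var[OF finite_subset[OF A(1) finite_atLeastAtMost]]
      by (intro contract_single_eq_0 hook_weight_prod_eq_0) (use A in auto)
    have out: "Var v \<in> hook_kernel a b" if "v = X i \<or> v = Y i" "i \<notin> {1..Suc (a + b)}" for v i
    proof -
      have "\<not> unmixed (Suc (a + b)) (m + Poly_Mapping.single v 1)" for m
        unfolding unmixed_def using that by (auto simp: lookup_add intro!: exI[of _ i])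
      then show ?thesis
        unfolding hook_kernel_def Var_def mem_Collect_eq
        by (intro contract_single_eq_0) (simp add: hook_weight_def)
    qed
    show "Var (X i) \<in> hook_kernel a b" "Var (Y i) \<in> hook_kernel a b" if "i \<notin> {1..Suc (a + b)}" for i
      using out that by blast+
  qed
next
  show "hook_kernel 0 0 \<subseteq> hook_ideal (\<lambda>i. Var (X i)) (\<lambda>i. Var (Y i)) 1 0 0"
  proof
    fix P assume "P \<in> hook_kernel 0 0"
    then have "contract P (hook_weight 1 0) 0 = 0"
      by (simp add: hook_kernel_def One_nat_def)
    then have "Poly_Mapping.lookup P 0 = 0"
      by (simp add: contract_def hook_weight_1 if_distrib[of "\<lambda>c. _ * c"] in_keys_iff cong: if_cong split: if_splits)
    then show "P \<in> hook_ideal (\<lambda>i. Var (X i)) (\<lambda>i. Var (Y i)) 1 0 0"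
      by (rule no_const_term_in_hook_ideal_1)
  qed
qed

section \<open>Differential operators and the determinant\<close>

abbreviation coef :: "mpol \<Rightarrow> expo \<Rightarrow> rat" where "coef \<equiv> Poly_Mapping.lookup"
abbreviation ex :: "expo \<Rightarrow> var \<Rightarrow> nat" where "ex \<equiv> Poly_Mapping.lookup"

lemma lookup_pdiff:
  "coef (pdiff v P) m = of_nat (Suc (ex m v)) * coef P (m + Poly_Mapping.single v 1)"
proof -
  let ?e = "Poly_Mapping.single v 1 :: expo"
  have "coef (pdiff v P) m = (\<Sum>k\<in>Poly_Mapping.keys P. if k - ?e = m then of_nat (ex k v) * coef P k else 0)"
    by (simp add: pdiff_def lookup_sum lookup_single when_def)
  also have "\<dots> = (\<Sum>k\<in>Poly_Mapping.keys P. if k = m + ?e then of_nat (ex k v) * coef P k else 0)"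
  proof (rule sum.cong[OF refl])
    fix k assume "k \<in> Poly_Mapping.keys P"
    show "(if k - ?e = m then of_nat (ex k v) * coef P k else 0)
        = (if k = m + ?e then of_nat (ex k v) * coef P k else 0)"
    proof (cases "ex k v = 0")
      case False
      then have "(k - ?e) + ?e = k"
        by (intro poly_mapping_eqI) (auto simp: lookup_add lookup_minus lookup_single when_def)
      then have "k - ?e = m \<longleftrightarrow> k = m + ?e" by auto
      then show ?thesis by simp
    qed simp
  qed
  also have "\<dots> = of_nat (Suc (ex m v)) * coef P (m + ?e)"
    by (auto simp: in_keys_iff lookup_add)
  finally show ?thesis .
qed

lemma lookup_pdiff_power:
  "coef ((pdiff v ^^ j) F) m * fact (ex m v) = fact (ex m v + j) * coef F (m + Poly_Mapping.single v j)"
proof (induction j arbitrary: m)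
  case (Suc j)
  let ?m = "m + Poly_Mapping.single v 1"
  have e: "ex ?m v = Suc (ex m v)" by (simp add: lookup_add)
  have "coef ((pdiff v ^^ Suc j) F) m * fact (ex m v) = coef ((pdiff v ^^ j) F) ?m * fact (ex ?m v)"
    by (simp add: lookup_pdiff e mult_ac)
  also have "\<dots> = fact (ex m v + Suc j) * coef F (?m + Poly_Mapping.single v j)"
    using Suc.IH[of ?m] by (simp only: e add_Suc_shift)
  also have "?m + Poly_Mapping.single v j = m + Poly_Mapping.single v (Suc j)"
    by (simp add: add.assoc plus_1_eq_Suc flip: single_add)
  finally show ?case .
qed simp

definition fact_expo :: "nat set \<Rightarrow> expo \<Rightarrow> rat" where
  "fact_expo S m = (\<Prod>i\<in>S. fact (ex m (X i)) * fact (ex m (Y i)))"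

text \<open>
  The part of a monomial that a product of derivatives over the indices \<open>S\<close> removes.
\<close>

definition expo_part :: "expo \<Rightarrow> nat set \<Rightarrow> expo" where
  "expo_part k S = (\<Sum>i\<in>S. Poly_Mapping.single (X i) (ex k (X i)) + Poly_Mapping.single (Y i) (ex k (Y i)))"

lemma lookup_expo_part:
  assumes "finite S"
  shows "ex (expo_part k S) (X i) = (if i \<in> S then ex k (X i) else 0)"
    "ex (expo_part k S) (Y i) = (if i \<in> S then ex k (Y i) else 0)"
  using assms by (simp_all add: expo_part_def lookup_sum lookup_add lookup_single when_def)

lemma expo_part_eq:
  assumes "Poly_Mapping.keys k \<subseteq> vars_upto n"
  shows "expo_part k {1..n} = k"
proof (rule poly_mapping_eqI)
  fix v
  have "ex k v = 0" if "v \<notin> vars_upto n" using that assms by (auto simp: in_keys_iff)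
  then show "ex (expo_part k {1..n}) v = ex k v"
    by (cases v) (auto simp: lookup_expo_part vars_upto_def simp del: atLeastAtMost_iff)
qed

lemma lookup_diff_monom_list:
  assumes "distinct is"
  shows "coef (foldr (\<lambda>i D. (pdiff (X i) ^^ ex k (X i)) \<circ> (pdiff (Y i) ^^ ex k (Y i)) \<circ> D) is id F) m
       * fact_expo (set is) m
     = fact_expo (set is) (m + expo_part k (set is)) * coef F (m + expo_part k (set is))"
  using assms
proof (induction "is" arbitrary: m)
  case Nil
  show ?case by (simp add: fact_expo_def expo_part_def)
next
  case (Cons i js)
  let ?D = "foldr (\<lambda>i D. (pdiff (X i) ^^ ex k (X i)) \<circ> (pdiff (Y i) ^^ ex k (Y i)) \<circ> D) js id F"
  let ?m1 = "m + Poly_Mapping.single (X i) (ex k (X i))"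
  let ?m2 = "?m1 + Poly_Mapping.single (Y i) (ex k (Y i))"
  have unfold: "foldr (\<lambda>i D. (pdiff (X i) ^^ ex k (X i)) \<circ> (pdiff (Y i) ^^ ex k (Y i)) \<circ> D) (i # js) id F
      = (pdiff (X i) ^^ ex k (X i)) ((pdiff (Y i) ^^ ex k (Y i)) ?D)"
    by simp
  have exY: "ex ?m1 (Y i) = ex m (Y i)" by (simp add: lookup_add lookup_single)
  have i: "i \<notin> set js" using Cons.prems by simp
  have same: "fact_expo (set js) ?m2 = fact_expo (set js) m"
    unfolding fact_expo_def using i
    by (intro prod.cong) (auto simp: lookup_add lookup_single when_def)
  have part: "?m2 + expo_part k (set js) = m + expo_part k (set (i # js))"
    using i by (simp add: expo_part_def add.assoc)
  have fx: "fact_expo (set (i # js)) m' = fact (ex m' (X i)) * fact (ex m' (Y i)) * fact_expo (set js) m'" for m'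
    using i by (simp add: fact_expo_def)
  have "coef ((pdiff (X i) ^^ ex k (X i)) ((pdiff (Y i) ^^ ex k (Y i)) ?D)) m * fact (ex m (X i)) * fact (ex m (Y i))
      = fact (ex m (X i) + ex k (X i)) * (coef ((pdiff (Y i) ^^ ex k (Y i)) ?D) ?m1 * fact (ex ?m1 (Y i)))"
    using lookup_pdiff_power[where v = "X i" and j = "ex k (X i)" and F = "(pdiff (Y i) ^^ ex k (Y i)) ?D" and m = m] by (simp only: exY mult_ac)
  also have "\<dots> = fact (ex m (X i) + ex k (X i)) * fact (ex m (Y i) + ex k (Y i)) * coef ?D ?m2"
    using lookup_pdiff_power[where v = "Y i" and j = "ex k (Y i)" and F = ?D and m = ?m1] by (simp only: exY mult.assoc)
  finally have step: "coef ((pdiff (X i) ^^ ex k (X i)) ((pdiff (Y i) ^^ ex k (Y i)) ?D)) m * fact (ex m (X i)) * fact (ex m (Y i))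
      = fact (ex m (X i) + ex k (X i)) * fact (ex m (Y i) + ex k (Y i)) * coef ?D ?m2" .
  have "coef ((pdiff (X i) ^^ ex k (X i)) ((pdiff (Y i) ^^ ex k (Y i)) ?D)) m * fact_expo (set (i # js)) m
      = (coef ((pdiff (X i) ^^ ex k (X i)) ((pdiff (Y i) ^^ ex k (Y i)) ?D)) m * fact (ex m (X i)) * fact (ex m (Y i)))
        * fact_expo (set js) m"
    by (simp only: fx mult.assoc)
  also have "\<dots> = fact (ex m (X i) + ex k (X i)) * fact (ex m (Y i) + ex k (Y i)) * (coef ?D ?m2 * fact_expo (set js) ?m2)"
    unfolding step same by (simp only: mult.assoc)
  also have "\<dots> = fact (ex m (X i) + ex k (X i)) * fact (ex m (Y i) + ex k (Y i))
      * fact_expo (set js) (m + expo_part k (set (i # js))) * coef F (m + expo_part k (set (i # js)))"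
    using Cons.IH[of ?m2] Cons.prems by (simp only: part distinct.simps mult.assoc)
  also have "\<dots> = fact_expo (set (i # js)) (m + expo_part k (set (i # js))) * coef F (m + expo_part k (set (i # js)))"
    by (simp only: fx) (simp add: lookup_add lookup_expo_part)
  finally show ?case by (simp only: unfold)
qed

lemma lookup_diff_monom:
  assumes "Poly_Mapping.keys k \<subseteq> vars_upto n"
  shows "coef (diff_monom n k F) m * fact_expo {1..n} m = fact_expo {1..n} (m + k) * coef F (m + k)"
proof -
  have "set [1..<n + 1] = {1..n}" by auto
  then show ?thesis
    using lookup_diff_monom_list[of "[1..<n + 1]" k F m] expo_part_eq[OF assms]
    by (simp only: diff_monom_def distinct_upt)
qed

lemma lookup_Const_mult: "coef (Const c * P) m = c * coef P m"
proof -
  have "coef (Poly_Mapping.map ((*) c) P) m = c * coef P m"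
    by (simp add: Poly_Mapping.map.rep_eq when_def)
  then show ?thesis by (simp add: Const_def mult_map_scale_conv_mult)
qed

lemma fact_expo_nonzero: "fact_expo S m \<noteq> 0"
  by (cases "finite S") (simp_all add: fact_expo_def)

text \<open>
  Derivatives become shifts when coefficients are multiplied by the factorials of their exponents,
  and these factorials are not zero.
\<close>

lemma diff_op_eq_0_iff:
  assumes "P \<in> carrier (poly_ring n)"
  shows "diff_op n P F = 0 \<longleftrightarrow> contract P (\<lambda>m. fact_expo {1..n} m * coef F m) = (\<lambda>_. 0)"
proof -
  have *: "coef (diff_op n P F) m * fact_expo {1..n} m = contract P (\<lambda>m. fact_expo {1..n} m * coef F m) m" for m
  proof -
    have "coef (diff_op n P F) m * fact_expo {1..n} m
        = (\<Sum>k\<in>Poly_Mapping.keys P. coef P k * (coef (diff_monom n k F) m * fact_expo {1..n} m))"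
      by (simp add: diff_op_def lookup_sum lookup_Const_mult sum_distrib_right mult.assoc)
    also have "\<dots> = (\<Sum>k\<in>Poly_Mapping.keys P. coef P k * (fact_expo {1..n} (m + k) * coef F (m + k)))"
      using assms by (intro sum.cong) (simp_all add: lookup_diff_monom carrier_poly_ring)
    finally show ?thesis by (simp add: contract_def)
  qed
  show ?thesis
  proof
    assume "diff_op n P F = 0"
    then show "contract P (\<lambda>m. fact_expo {1..n} m * coef F m) = (\<lambda>_. 0)"
      by (simp add: fun_eq_iff flip: * )
  next
    assume "contract P (\<lambda>m. fact_expo {1..n} m * coef F m) = (\<lambda>_. 0)"
    then have "coef (diff_op n P F) m * fact_expo {1..n} m = 0" for m by (simp add: * )
    then show "diff_op n P F = 0"
      using fact_expo_nonzero by (intro poly_mapping_eqI) simp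
  qed
qed

context
  fixes K L n :: nat
  assumes n: "n = K + L + 1"
begin

lemma K_less: "K < n"
  using n by simp

definition column_expo :: "nat \<Rightarrow> nat \<Rightarrow> expo" where
  "column_expo i j = Poly_Mapping.single (X (i + 1)) (fst (hook_biexponents K L ! j))
     + Poly_Mapping.single (Y (i + 1)) (snd (hook_biexponents K L ! j))"

definition perm_expo :: "(nat \<Rightarrow> nat) \<Rightarrow> expo" where
  "perm_expo p = (\<Sum>i = 0..<n. column_expo i (p i))"

text \<open>
  The column with biexponent \<open>(p, q)\<close> has signed exponent \<open>p - q\<close>, hence rank \<open>p - q + K + 1\<close>. The value \<open>0\<close> at \<open>n\<close>
  makes \<open>rank\<close> a permutation of \<open>{0..n}\<close>; it matches \<open>pred_cycle\<close>, which translates the variable index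
  \<open>i\<close> to the matrix row \<open>i - 1\<close>.
\<close>

definition rank :: "nat \<Rightarrow> nat" where
  "rank j = (if j < n then if j \<le> K then K + 1 - j else j + 1 else if j = n then 0 else j)"

definition pred_cycle :: "nat \<Rightarrow> nat" where
  "pred_cycle i = (if i = 0 then n else if i \<le> n then i - 1 else i)"

lemma length_biexponents: "length (hook_biexponents K L) = n"
  by (simp add: hook_biexponents_def n)

lemma nth_biexponents:
  "j < n \<Longrightarrow> hook_biexponents K L ! j = (if j \<le> K then (0, j) else (j - K, 0))"
  unfolding n by (auto simp: hook_biexponents_def nth_append)

lemma rank_permutes: "rank permutes {0..n}"
  by (rule inj_imp_permutes) (use K_less in \<open>auto simp: rank_def inj_on_def split: if_splits\<close>)

lemma pred_cycle_permutes: "pred_cycle permutes {0..n}"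
  by (rule inj_imp_permutes) (auto simp: pred_cycle_def inj_on_def split: if_splits)

lemma lookup_perm_expo:
  "ex (perm_expo p) (X i) = (if i \<in> {1..n} then fst (hook_biexponents K L ! p (i - 1)) else 0)"
  "ex (perm_expo p) (Y i) = (if i \<in> {1..n} then snd (hook_biexponents K L ! p (i - 1)) else 0)"
proof -
  have *: "(\<Sum>j = 0..<n. if j + 1 = i then f j else 0) = (if i \<in> {1..n} then f (i - 1) else 0)" for f :: "nat \<Rightarrow> nat"
  proof (cases "i \<in> {1..n}")
    case True
    then have "j + 1 = i \<longleftrightarrow> j = i - 1" for j by auto
    then show ?thesis using True by (auto simp: sum.delta)
  next
    case False
    then show ?thesis by (auto intro!: sum.neutral)
  qed
  have "ex (perm_expo p) (X i) = (\<Sum>j = 0..<n. if j + 1 = i then fst (hook_biexponents K L ! p j) else 0)"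
    by (simp add: perm_expo_def column_expo_def lookup_sum lookup_add lookup_single when_def)
  then show "ex (perm_expo p) (X i) = (if i \<in> {1..n} then fst (hook_biexponents K L ! p (i - 1)) else 0)"
    by (simp only: * )
  have "ex (perm_expo p) (Y i) = (\<Sum>j = 0..<n. if j + 1 = i then snd (hook_biexponents K L ! p j) else 0)"
    by (simp add: perm_expo_def column_expo_def lookup_sum lookup_add lookup_single when_def)
  then show "ex (perm_expo p) (Y i) = (if i \<in> {1..n} then snd (hook_biexponents K L ! p (i - 1)) else 0)"
    by (simp only: * )
qed

lemma perm_below: "p permutes {0..<n} \<Longrightarrow> i \<in> {1..n} \<Longrightarrow> p (i - 1) < n"
  using permutes_in_image[of p "{0..<n}" "i - 1"] by auto

lemma unmixed_perm_expo:
  assumes "p permutes {0..<n}"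
  shows "unmixed n (perm_expo p)"
  using perm_below[OF assms] by (auto simp: unmixed_def lookup_perm_expo nth_biexponents simp del: atLeastAtMost_iff)

text \<open>
  All permutations act on \<open>{0..n}\<close>, so the signs of the two index conventions differ by the
  constant factor \<open>sign rank * sign pred_cycle\<close>.
\<close>

lemma hook_perm_perm_expo:
  assumes p: "p permutes {0..<n}"
  shows "hook_perm n K (perm_expo p) = rank \<circ> p \<circ> pred_cycle"
proof
  fix i
  consider "i \<in> {1..n}" | "i = 0" | "i > n" by fastforce
  then show "hook_perm n K (perm_expo p) i = (rank \<circ> p \<circ> pred_cycle) i"
  proof cases
    case 1
    have j: "p (i - 1) < n" by (rule perm_below[OF p 1])
    have "hook_perm n K (perm_expo p) i = rank (p (i - 1))"
      using 1 j by (auto simp: hook_perm_def signed_exp_def lookup_perm_expo nth_biexponents rank_def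
          simp del: atLeastAtMost_iff)
    moreover have "pred_cycle i = i - 1" using 1 by (simp add: pred_cycle_def)
    ultimately show ?thesis by simp
  next
    case 2
    have "p n = n" using permutes_not_in[OF p, of n] by simp
    then show ?thesis using 2 by (simp add: hook_perm_def pred_cycle_def rank_def)
  next
    case 3
    then have "p i = i" using permutes_not_in[OF p, of i] by simp
    then show ?thesis using 3 by (simp add: hook_perm_def pred_cycle_def rank_def)
  qed
qed

lemma perm_expo_surj:
  assumes u: "unmixed n m" and hp: "hook_perm n K m permutes {1..n}"
  obtains p where "p permutes {0..<n}" "perm_expo p = m"
proof -
  define p where "p = inv_into UNIV rank \<circ> hook_perm n K m \<circ> inv_into UNIV pred_cycle"
  have hp0: "hook_perm n K m permutes {0..n}" by (rule permutes_subset[OF hp]) auto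
  have p0: "p permutes {0..n}"
    unfolding p_def by (intro permutes_compose permutes_inv rank_permutes pred_cycle_permutes hp0)
  have "inv_into UNIV pred_cycle n = 0"
    using permutes_inv_eq[OF pred_cycle_permutes, of n 0] by (simp add: pred_cycle_def)
  moreover have "inv_into UNIV rank 0 = n"
    using permutes_inv_eq[OF rank_permutes, of 0 n] by (simp add: rank_def)
  moreover have "hook_perm n K m 0 = 0" by (simp add: hook_perm_def)
  ultimately have "p n = n" by (simp add: p_def)
  then have p: "p permutes {0..<n}"
    by (intro permutes_superset[OF p0]) (auto simp: le_less)
  have eq: "rank \<circ> p \<circ> pred_cycle = hook_perm n K m"
    unfolding p_def by (auto simp: fun_eq_iff permutes_inverses[OF rank_permutes] permutes_inverses[OF pred_cycle_permutes])
  have "perm_expo p = m"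
  proof (rule poly_mapping_eqI)
    have *: "ex (perm_expo p) (X i) = ex m (X i) \<and> ex (perm_expo p) (Y i) = ex m (Y i)" for i
    proof (cases "i \<in> {1..n}")
      case True
      have j: "p (i - 1) < n" by (rule perm_below[OF p True])
      have "hook_perm n K m i = hook_perm n K (perm_expo p) i"
        by (simp only: hook_perm_perm_expo[OF p] eq)
      moreover have "hook_perm n K m i \<in> {1..n}" using permutes_in_image[OF hp, of i] True by simp
      ultimately have "signed_exp m i = signed_exp (perm_expo p) i"
        using True by (auto simp: hook_perm_def)
      moreover have "ex m (X i) = 0 \<or> ex m (Y i) = 0"
        "ex (perm_expo p) (X i) = 0 \<or> ex (perm_expo p) (Y i) = 0"
        using u unmixed_perm_expo[OF p] by (auto simp: unmixed_def)
      ultimately show ?thesis by (auto simp: signed_exp_def)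
    next
      case False
      then show ?thesis using u unmixed_perm_expo[OF p] unfolding unmixed_def by metis
    qed
    fix v show "ex (perm_expo p) v = ex m v" using * by (cases v) auto
  qed
  then show thesis using p that by blast
qed

lemma lookup_Delta:
  "coef (Delta (hook_biexponents K L)) m
     = (\<Sum>p | p permutes {0..<n}. if perm_expo p = m then of_int (sign p) else 0)"
proof -
  let ?f = "\<lambda>(i, j). Var (X (i + 1)) ^ fst (hook_biexponents K L ! j) * Var (Y (i + 1)) ^ snd (hook_biexponents K L ! j)"
  have f: "?f (i, j) = Poly_Mapping.single (column_expo i j) 1" for i j
    by (simp add: Var_power mult_single column_expo_def)
  have entry: "signof p * (\<Prod>i = 0..<n. mat n n ?f $$ (i, p i)) = Poly_Mapping.single (perm_expo p) (of_int (sign p))"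
    if p: "p permutes {0..<n}" for p
  proof -
    have "(\<Prod>i = 0..<n. mat n n ?f $$ (i, p i)) = (\<Prod>i = 0..<n. Poly_Mapping.single (column_expo i (p i)) 1)"
    proof (rule prod.cong[OF refl])
      fix i assume "i \<in> {0..<n}"
      then have "i < n" "p i < n" using permutes_in_image[OF p, of i] by auto
      then show "mat n n ?f $$ (i, p i) = Poly_Mapping.single (column_expo i (p i)) 1"
        by (simp only: index_mat(1) f)
    qed
    also have "\<dots> = Poly_Mapping.single (perm_expo p) 1"
      unfolding perm_expo_def by (rule prod_single) simp
    finally show ?thesis by (simp add: single_uminus sign_def)
  qed
  have "Delta (hook_biexponents K L) = (\<Sum>p | p permutes {0..<n}. Poly_Mapping.single (perm_expo p) (of_int (sign p)))"
    unfolding Delta_def length_biexponents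
    using det_def'[of "mat n n ?f" n] sum.cong[OF refl entry, of "{p. p permutes {0..<n}}"]
    by (simp only: mat_carrier mem_Collect_eq)
  then show ?thesis by (simp add: lookup_sum lookup_single when_def)
qed

lemma fact_expo_perm_expo:
  assumes p: "p permutes {0..<n}"
  shows "fact_expo {1..n} (perm_expo p)
     = (\<Prod>j = 0..<n. fact (fst (hook_biexponents K L ! j)) * fact (snd (hook_biexponents K L ! j)))"
proof -
  let ?g = "\<lambda>j. fact (fst (hook_biexponents K L ! j)) * fact (snd (hook_biexponents K L ! j)) :: rat"
  have "fact_expo {1..n} (perm_expo p) = (\<Prod>i = 1..n. ?g (p (i - 1)))"
    unfolding fact_expo_def by (intro prod.cong) (auto simp: lookup_perm_expo)
  also have "\<dots> = (\<Prod>i = 0..<n. ?g (p i))"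
    by (rule prod.reindex_bij_witness[of _ Suc "\<lambda>i. i - 1"]) auto
  also have "\<dots> = (\<Prod>j = 0..<n. ?g j)"
    using prod.permute[OF p, of ?g] by (simp add: comp_def)
  finally show ?thesis .
qed

text \<open>
  Different terms of the determinant have different monomials, so each coefficient of \<open>\<Delta>\<close> is a sign or
  \<open>0\<close>; the exponents in each monomial are the same up to order, so their factorials contribute a constant.
\<close>

lemma Delta_weight:
  "\<exists>c \<noteq> 0. \<forall>m. fact_expo {1..n} m * coef (Delta (hook_biexponents K L)) m = c * hook_weight n K m"
proof -
  define g :: rat where
    "g = (\<Prod>j = 0..<n. fact (fst (hook_biexponents K L ! j)) * fact (snd (hook_biexponents K L ! j)))"
  define s :: rat where "s = of_int (sign rank * sign pred_cycle)"
  have "fact_expo {1..n} m * coef (Delta (hook_biexponents K L)) m = g * s * hook_weight n K m" for m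
  proof (cases "unmixed n m \<and> hook_perm n K m permutes {1..n}")
    case True
    then obtain p where p: "p permutes {0..<n}" "perm_expo p = m" using perm_expo_surj by blast
    have uniq: "q = p" if q: "q permutes {0..<n}" "perm_expo q = m" for q
    proof -
      have "rank \<circ> q \<circ> pred_cycle = rank \<circ> p \<circ> pred_cycle"
        using hook_perm_perm_expo[OF q(1)] hook_perm_perm_expo[OF p(1)] p q by simp
      then have "rank (q (pred_cycle i)) = rank (p (pred_cycle i))" for i by (simp add: fun_eq_iff)
      then have "q (pred_cycle i) = p (pred_cycle i)" for i
        using permutes_inj[OF rank_permutes] by (metis injD)
      then show ?thesis using permutes_surj[OF pred_cycle_permutes] by (metis ext surjD)
    qed
    have "coef (Delta (hook_biexponents K L)) m = (\<Sum>q | q permutes {0..<n}. if q = p then of_int (sign q) else 0)"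
      unfolding lookup_Delta
    proof (rule sum.cong[OF refl])
      fix q assume "q \<in> {q. q permutes {0..<n}}"
      then have "perm_expo q = m \<longleftrightarrow> q = p" using uniq[of q] p(2) by blast
      then show "(if perm_expo q = m then of_int (sign q) else 0) = (if q = p then of_int (sign q) else (0 :: rat))"
        by simp
    qed
    also have "\<dots> = of_int (sign p)"
      using p by (simp add: finite_permutations)
    finally have D: "coef (Delta (hook_biexponents K L)) m = of_int (sign p)" .
    have "permutation rank" "permutation pred_cycle" "permutation p"
      using rank_permutes pred_cycle_permutes p(1) permutation_permutes by blast+
    then have "sign (hook_perm n K m) = sign rank * sign p * sign pred_cycle"
      using hook_perm_perm_expo[OF p(1)] p(2) by (simp add: sign_compose permutation_compose)
    then have "hook_weight n K m = s * of_int (sign p)"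
      using True by (simp add: hook_weight_def s_def mult_ac)
    moreover have "s * s = 1"
      unfolding s_def by (simp flip: of_int_mult) (simp add: mult_ac)
    ultimately have "g * s * hook_weight n K m = g * of_int (sign p)"
      by (simp add: mult.assoc)
    then show ?thesis
      using fact_expo_perm_expo[OF p(1)] p(2) D by (simp add: g_def)
  next
    case False
    then have "perm_expo p \<noteq> m" if p: "p permutes {0..<n}" for p
    proof -
      have "p permutes {0..n}" by (rule permutes_subset[OF p]) auto
      then have "hook_perm n K (perm_expo p) permutes {0..n}"
        unfolding hook_perm_perm_expo[OF p]
        by (intro permutes_compose rank_permutes pred_cycle_permutes)
      then have "hook_perm n K (perm_expo p) permutes {1..n}"
        by (rule permutes_superset) (auto simp: hook_perm_def)
      then show ?thesis using False unmixed_perm_expo[OF p] by blast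
    qed
    then have "coef (Delta (hook_biexponents K L)) m = 0"
      unfolding lookup_Delta by (intro sum.neutral) auto
    then show ?thesis using False by (auto simp: hook_weight_def)
  qed
  moreover have "g * s \<noteq> 0" by (simp add: g_def s_def)
  ultimately show ?thesis by blast
qed

lemma hook_annihilator_eq:
  "hook_annihilator K L = carrier (poly_ring n) \<inter> hook_ideal (\<lambda>i. Var (X i)) (\<lambda>i. Var (Y i)) n L K"
proof -
  obtain c where c: "c \<noteq> 0" "\<And>m. fact_expo {1..n} m * coef (Delta (hook_biexponents K L)) m = c * hook_weight n K m"
    using Delta_weight by blast
  have n': "Suc (L + K) = n" using n by simp
  have "diff_op n P (Delta (hook_biexponents K L)) = 0 \<longleftrightarrow> P \<in> hook_kernel L K"
    if "P \<in> carrier (poly_ring n)" for P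
    unfolding diff_op_eq_0_iff[OF that] c(2) hook_kernel_def n'
    using c(1) by (simp add: fun_eq_iff contract_scaled_weight)
  then show ?thesis
    unfolding hook_annihilator_def hook.I_eq_hook_ideal[of L K, unfolded n', symmetric] n[symmetric]
    by blast
qed

end


section \<open>Back to the polynomial ring in finitely many variables\<close>

text \<open>
  Setting the variables outside \<open>vars_upto n\<close> to zero is a ring homomorphism that kills the additional
  generators of \<open>hook_ideal\<close> and fixes \<open>poly_ring n\<close>. It carries memberships in the big ring to the small one.
\<close>

definition poly_retract :: "nat \<Rightarrow> mpol \<Rightarrow> mpol" where
  "poly_retract n P = (\<Sum>k \<in> Poly_Mapping.keys P.
     if Poly_Mapping.keys k \<subseteq> vars_upto n then Poly_Mapping.single k (coef P k) else 0)"

lemma lookup_poly_retract: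
  "coef (poly_retract n P) k = (if Poly_Mapping.keys k \<subseteq> vars_upto n then coef P k else 0)"
proof -
  have "coef (poly_retract n P) k
      = (\<Sum>l\<in>Poly_Mapping.keys P. if l = k then if Poly_Mapping.keys k \<subseteq> vars_upto n then coef P k else 0 else 0)"
    unfolding poly_retract_def lookup_sum
    by (rule sum.cong) (auto simp: lookup_single when_def)
  then show ?thesis by (auto simp: in_keys_iff)
qed

lemma poly_retract_add: "poly_retract n (P + Q) = poly_retract n P + poly_retract n Q"
  by (rule poly_mapping_eqI) (simp add: lookup_poly_retract lookup_add)

lemma poly_retract_single:
  "poly_retract n (Poly_Mapping.single k c) = (if Poly_Mapping.keys k \<subseteq> vars_upto n then Poly_Mapping.single k c else 0)"
  by (rule poly_mapping_eqI) (auto simp: lookup_poly_retract lookup_single when_def)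

lemma poly_retract_0: "poly_retract n 0 = 0"
  by (simp add: poly_retract_def)

lemma keys_expo_add: "Poly_Mapping.keys (k + l :: expo) = Poly_Mapping.keys k \<union> Poly_Mapping.keys l"
  by (auto simp: in_keys_iff lookup_add)

lemma poly_retract_mult: "poly_retract n (P * Q) = poly_retract n P * poly_retract n Q"
proof (induction P rule: poly_mapping_induct)
  case (single k)
  show ?case
    by (induction Q rule: poly_mapping_induct)
       (auto simp: poly_retract_0 distrib_left poly_retract_add mult_single poly_retract_single keys_expo_add)
qed (simp_all add: poly_retract_0 distrib_right poly_retract_add)

lemma poly_retract_in_carrier: "poly_retract n P \<in> carrier (poly_ring n)"
  unfolding carrier_poly_ring
  by (auto simp: in_keys_iff[of _ "poly_retract n P"] lookup_poly_retract split: if_splits)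

lemma poly_retract_id: "P \<in> carrier (poly_ring n) \<Longrightarrow> poly_retract n P = P"
  by (rule poly_mapping_eqI) (auto simp: lookup_poly_retract carrier_poly_ring in_keys_iff)

lemma Var_in_carrier: "v \<in> vars_upto n \<Longrightarrow> Var v \<in> carrier (poly_ring n)"
  by (auto simp: carrier_poly_ring Var_def)

lemma poly_retract_Var: "v \<notin> vars_upto n \<Longrightarrow> poly_retract n (Var v) = 0"
  by (simp add: Var_def poly_retract_single)

lemma carrier_mult: "P \<in> carrier (poly_ring n) \<Longrightarrow> Q \<in> carrier (poly_ring n) \<Longrightarrow> P * Q \<in> carrier (poly_ring n)"
  by (metis poly_retract_id poly_retract_in_carrier poly_retract_mult)

lemma carrier_add: "P \<in> carrier (poly_ring n) \<Longrightarrow> Q \<in> carrier (poly_ring n) \<Longrightarrow> P + Q \<in> carrier (poly_ring n)"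
  by (metis poly_retract_id poly_retract_in_carrier poly_retract_add)

lemma carrier_one: "1 \<in> carrier (poly_ring n)"
  by (simp add: carrier_poly_ring)

lemma carrier_zero: "0 \<in> carrier (poly_ring n)"
  by (simp add: carrier_poly_ring)

lemma carrier_prod: "(\<And>i. i \<in> A \<Longrightarrow> f i \<in> carrier (poly_ring n)) \<Longrightarrow> prod f A \<in> carrier (poly_ring n)"
  by (induction A rule: infinite_finite_induct) (auto intro: carrier_mult carrier_one)

lemma carrier_prod_mset: "(\<And>i. i \<in># M \<Longrightarrow> f i \<in> carrier (poly_ring n)) \<Longrightarrow> (\<Prod>i\<in>#M. f i) \<in> carrier (poly_ring n)"
  by (induction M) (auto intro: carrier_mult carrier_one)

lemma carrier_sum: "(\<And>i. i \<in> A \<Longrightarrow> f i \<in> carrier (poly_ring n)) \<Longrightarrow> sum f A \<in> carrier (poly_ring n)"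
  by (induction A rule: infinite_finite_induct) (auto intro: carrier_add carrier_zero)

lemma carrier_hsym:
  "(\<And>i. i \<in> {1..n} \<Longrightarrow> z i \<in> carrier (poly_ring n)) \<Longrightarrow> hsym {1..n} k z \<in> carrier (poly_ring n)"
  unfolding hsym_def by (intro carrier_sum carrier_prod_mset) (auto simp: multisets_of_size_def subset_iff simp del: atLeastAtMost_iff)

lemma ideal_carrier_Int:
  assumes S: "is_ideal S"
  shows "ideal (carrier (poly_ring n) \<inter> S) (poly_ring n)"
proof (rule idealI)
  interpret R: cring "poly_ring n" by (rule poly_ring_cring)
  show "Ring.ring (poly_ring n)" by (rule R.ring_axioms)
  show "subgroup (carrier (poly_ring n) \<inter> S) (add_monoid (poly_ring n))"
  proof (rule group.subgroupI)
    show "group (add_monoid (poly_ring n))" by (rule R.add.group_axioms)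
    show "carrier (poly_ring n) \<inter> S \<noteq> {}"
      using carrier_zero[of n] ideals.subspace_0[OF S] by blast
    fix P assume P: "P \<in> carrier (poly_ring n) \<inter> S"
    have neg: "- P \<in> carrier (poly_ring n)"
      using P by (auto simp: carrier_poly_ring in_keys_iff)
    then have "\<ominus>\<^bsub>poly_ring n\<^esub> P = - P"
      using P R.minus_equality[of "- P" P] by simp
    then show "inv\<^bsub>add_monoid (poly_ring n)\<^esub> P \<in> carrier (poly_ring n) \<inter> S"
      using neg P ideals.subspace_neg[OF S] by (simp add: a_inv_def)
  next
    fix P Q assume "P \<in> carrier (poly_ring n) \<inter> S" "Q \<in> carrier (poly_ring n) \<inter> S"
    then show "P \<otimes>\<^bsub>add_monoid (poly_ring n)\<^esub> Q \<in> carrier (poly_ring n) \<inter> S"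
      using ideal_add[OF S] carrier_add by simp
  qed simp
  fix P Q assume "P \<in> carrier (poly_ring n) \<inter> S" "Q \<in> carrier (poly_ring n)"
  then show "Q \<otimes>\<^bsub>poly_ring n\<^esub> P \<in> carrier (poly_ring n) \<inter> S" "P \<otimes>\<^bsub>poly_ring n\<^esub> Q \<in> carrier (poly_ring n) \<inter> S"
    using ideal_mult[OF S] ideal_mult'[OF S] carrier_mult by auto
qed

theorem theorem2:
  fixes K L n :: nat
  assumes "n = K + L + 1"
  shows "hook_annihilator K L =
    Idl\<^bsub>poly_ring n\<^esub>
      ({complete_hom i n (\<lambda>j. Var (X j)) | i. 1 \<le> i \<and> i \<le> n}
     \<union> {complete_hom i n (\<lambda>j. Var (Y j)) | i. 1 \<le> i \<and> i \<le> n}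
     \<union> {Var (X i) * Var (Y i) | i. 1 \<le> i \<and> i \<le> n}
     \<union> {\<Prod>i\<in>A. Var (X i) | A. A \<subseteq> {1..n} \<and> card A = L + 1}
     \<union> {\<Prod>i\<in>B. Var (Y i) | B. B \<subseteq> {1..n} \<and> card B = K + 1})"
    (is "_ = Idl\<^bsub>poly_ring n\<^esub> ?gens")
proof -
  interpret R: cring "poly_ring n" by (rule poly_ring_cring)
  let ?J = "hook_ideal (\<lambda>i. Var (X i)) (\<lambda>i. Var (Y i)) n L K"
  have h: "complete_hom i n z = hsym {1..n} i z" for i z
    by (simp add: complete_hom_def hsym_def)
  have X: "Var (X i) \<in> carrier (poly_ring n)" and Y: "Var (Y i) \<in> carrier (poly_ring n)" if "i \<in> {1..n}" for i
    using that by (auto intro!: Var_in_carrier simp: vars_upto_def simp del: atLeastAtMost_iff)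
  have carrier: "?gens \<subseteq> carrier (poly_ring n)"
  proof (intro Un_least subsetI; elim CollectE exE conjE; hypsubst)
    fix i assume "1 \<le> i" "i \<le> n"
    then have i: "i \<in> {1..n}" by simp
    show "complete_hom i n (\<lambda>j. Var (X j)) \<in> carrier (poly_ring n)"
      unfolding h by (intro carrier_hsym X)
    show "complete_hom i n (\<lambda>j. Var (Y j)) \<in> carrier (poly_ring n)"
      unfolding h by (intro carrier_hsym Y)
    show "Var (X i) * Var (Y i) \<in> carrier (poly_ring n)"
      by (intro carrier_mult X Y i)
  next
    fix A assume "A \<subseteq> {1..n}"
    then show "(\<Prod>i\<in>A. Var (X i)) \<in> carrier (poly_ring n)" "(\<Prod>i\<in>A. Var (Y i)) \<in> carrier (poly_ring n)"
      by (intro carrier_prod X Y; blast)+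
  qed
  have idl: "ideal (Idl\<^bsub>poly_ring n\<^esub> ?gens) (poly_ring n)"
    by (rule R.genideal_ideal[OF carrier])
  have gens: "p \<in> Idl\<^bsub>poly_ring n\<^esub> ?gens" if "p \<in> ?gens" for p
    using R.genideal_self[OF carrier] that by blast
  have "?J \<subseteq> {P. poly_retract n P \<in> Idl\<^bsub>poly_ring n\<^esub> ?gens}" (is "_ \<subseteq> ?S")
  proof (rule hook_ideal_leI)
    have zero: "0 \<in> Idl\<^bsub>poly_ring n\<^esub> ?gens"
      using additive_subgroup.zero_closed[OF ideal.axioms(1)[OF idl]] by simp
    show "is_ideal ?S"
    proof (rule ideals.subspaceI)
      show "0 \<in> ?S" using zero by (simp add: poly_retract_0)
      show "p + q \<in> ?S" if "p \<in> ?S" "q \<in> ?S" for p q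
        using additive_subgroup.a_closed[OF ideal.axioms(1)[OF idl], of "poly_retract n p" "poly_retract n q"] that
        by (simp add: poly_retract_add)
      show "c * p \<in> ?S" if "p \<in> ?S" for c p
        using ideal.I_l_closed[OF idl, of "poly_retract n p" "poly_retract n c"] that poly_retract_in_carrier
        by (simp add: poly_retract_mult)
    qed
    have in_S: "p \<in> ?S" if "p \<in> ?gens" for p
      using gens[OF that] subsetD[OF carrier that] by (simp add: poly_retract_id)
    fix i assume i: "1 \<le> i" "i \<le> n"
    show "hsym {1..n} i (\<lambda>j. Var (X j)) \<in> ?S" by (rule in_S, unfold h[symmetric]) (use i in blast)
    show "hsym {1..n} i (\<lambda>j. Var (Y j)) \<in> ?S" by (rule in_S, unfold h[symmetric]) (use i in blast)
    show "Var (X i) * Var (Y i) \<in> ?S" by (rule in_S) (use i in blast)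
  next
    have in_S: "p \<in> ?S" if "p \<in> ?gens" for p
      using gens[OF that] subsetD[OF carrier that] by (simp add: poly_retract_id)
    fix A assume A: "A \<subseteq> {1..n}"
    show "(\<Prod>i\<in>A. Var (X i)) \<in> ?S" if "card A = Suc L"
      by (rule in_S) (use A that[unfolded Suc_eq_plus1] in blast)
    show "(\<Prod>i\<in>A. Var (Y i)) \<in> ?S" if "card A = Suc K"
      by (rule in_S) (use A that[unfolded Suc_eq_plus1] in blast)
  next
    have zero: "0 \<in> Idl\<^bsub>poly_ring n\<^esub> ?gens"
      using additive_subgroup.zero_closed[OF ideal.axioms(1)[OF idl]] by simp
    fix i assume "i \<notin> {1..n}"
    then have "X i \<notin> vars_upto n" "Y i \<notin> vars_upto n"
      by (auto simp: vars_upto_def simp del: atLeastAtMost_iff)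
    then show "Var (X i) \<in> ?S" "Var (Y i) \<in> ?S"
      using zero by (simp_all add: poly_retract_Var)
  qed
  then have "carrier (poly_ring n) \<inter> ?J \<subseteq> Idl\<^bsub>poly_ring n\<^esub> ?gens"
    using poly_retract_id by fastforce
  moreover have "Idl\<^bsub>poly_ring n\<^esub> ?gens \<subseteq> carrier (poly_ring n) \<inter> ?J"
  proof (rule R.genideal_minimal[OF ideal_carrier_Int[OF is_ideal_hook_ideal]])
    have "?gens \<subseteq> ?J"
    proof (intro Un_least subsetI; elim CollectE exE conjE; hypsubst)
      fix i assume i: "1 \<le> i" "i \<le> n"
      show "complete_hom i n (\<lambda>j. Var (X j)) \<in> ?J" "complete_hom i n (\<lambda>j. Var (Y j)) \<in> ?J"
        unfolding h using i by (simp_all add: hsym_in_hook_ideal)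
      show "Var (X i) * Var (Y i) \<in> ?J" by (rule xy_in_hook_ideal)
    next
      fix A assume A: "A \<subseteq> {1..n}"
      show "(\<Prod>i\<in>A. Var (X i)) \<in> ?J" if "card A = L + 1"
        by (rule prod_x_in_hook_ideal) (use A that in auto)
      show "(\<Prod>i\<in>A. Var (Y i)) \<in> ?J" if "card A = K + 1"
        by (rule prod_y_in_hook_ideal) (use A that in auto)
    qed
    with carrier show "?gens \<subseteq> carrier (poly_ring n) \<inter> ?J" by (rule Int_greatest)
  qed
  ultimately show ?thesis
    unfolding hook_annihilator_eq[OF assms] by (rule equalityI)
qed

end
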